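(* Let $n \ge 3$ be an integer. The natural density $\rho(\widetilde E)$ of the set $\widetilde E\subseteq\mathbb{Z}^{n+1}$ of affine Eisenstein polynomials of degree $n$ exists and equals $$\rho(\widetilde E) = 1 - \prod_{p \text{ prime}} \left(1 - \frac{(p+1)(p-1)^2}{p^{n+2}}\right).$$
   Context: Polynomials in $\mathbb{Z}[x]$ of degree at most $n$ are identified with $\mathbb{Z}^{n+1}$ via their coefficients in the basis $\{1,x,\dots,x^n\}$. A polynomial $f(x)=\sum_{i=0}^n\alpha_i x^i\in\mathbb{Z}[x]$ of degree $n$ is $p$-Eisenstein, for a prime $p$, if $p\nmid\alpha_n$, $p\mid\alpha_i$ for all $i\in\{0,\dots,n-1\}$, and $p^2\nmid\alpha_0$. It is Eisenstein if it is $p$-Eisenstein for some prime $p$. Let $E\subseteq\mathbb{Z}^{n+1}$ be the set of Eisenstein polynomials of degree (exactly) $n$. For $f(x)=\sum_{i=0}^n\alpha_i x^i\in\mathbb{Z}^{n+1}$ and $A=\begin{pmatrix} a&b\\c&d\end{pmatrix}\in\mathbb{Z}^{2\times2}$, the affine transformation of $f$ by $A$ is the polynomial $f*A:=(cx+d)^n f\left(\frac{ax+b}{cx+d}\right)=\sum_{i=0}^n\alpha_i(ax+b)^i(cx+d)^{n-i}$, of degree at most $n$. The set of affine Eisenstein polynomials of degree $n$ is $\widetilde E=\{f(x)\in\mathbb{Z}^{n+1} : f \text{ has degree exactly } n \text{ and } f*A\in E\text{ for some }A\in\mathbb{Z}^{2\times2}\}$. For $A\subseteq\mathbb{Z}^d$,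 the natural density of $A$ is $\rho(A)=\lim_{B\to\infty}\frac{|A\cap[-B,B)^d|}{(2B)^d}$, when the limit exists. Here $d=n+1$. *)

theory Defs
  imports "HOL-Analysis.Analysis" "HOL-Computational_Algebra.Computational_Algebra"
begin

definition eisenstein_at :: "nat \<Rightarrow> int poly \<Rightarrow> bool" where
  "eisenstein_at p f \<longleftrightarrow>
     \<not> int p dvd coeff f (degree f) \<and>
     (\<forall>i<degree f. int p dvd coeff f i) \<and>
     \<not> (int p)\<^sup>2 dvd coeff f 0"

definition eisenstein_polys :: "nat \<Rightarrow> int poly set" where
  "eisenstein_polys n = {f. degree f = n \<and> (\<exists>p. prime p \<and> eisenstein_at p f)}"

text \<open>
  For \<open>A\<close> with rows \<open>(a, b)\<close> and \<open>(c, d)\<close>, this is the homogenised substitution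
  \<open>(cx + d)^n f((ax + b) / (cx + d))\<close>, where \<open>n\<close> bounds the degree of \<open>f\<close>.
  Note that \<open>[:b, a:]\<close> is \<open>ax + b\<close>.
\<close>

definition affine_transform :: "nat \<Rightarrow> int poly \<Rightarrow> int^2^2 \<Rightarrow> int poly" where
  "affine_transform n f A =
     (\<Sum>i\<le>n. smult (coeff f i) ([:A$1$2, A$1$1:] ^ i * [:A$2$2, A$2$1:] ^ (n - i)))"

text \<open>\<open>A\<close> ranges over all integer matrices; it need not be invertible.\<close>

definition affine_eisenstein_polys :: "nat \<Rightarrow> int poly set" where
  "affine_eisenstein_polys n =
     {f. degree f = n \<and> (\<exists>A :: int^2^2. affine_transform n f A \<in> eisenstein_polys n)}"

text \<open>
  \<open>\<int>^d\<close> is represented by the functions in \<open>{..<d} \<rightarrow>\<^sub>E UNIV\<close>, which are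
  \<open>undefined\<close> outside \<open>{..<d}\<close>, so that each vector is represented exactly once.
\<close>

definition coeff_vec :: "nat \<Rightarrow> int poly \<Rightarrow> nat \<Rightarrow> int" where
  "coeff_vec n f = restrict (coeff f) {..<n + 1}"

definition int_box :: "nat \<Rightarrow> real \<Rightarrow> (nat \<Rightarrow> int) set" where
  "int_box d B = {..<d} \<rightarrow>\<^sub>E {k. real_of_int k \<in> {-B..<B}}"

definition has_natural_density :: "nat \<Rightarrow> (nat \<Rightarrow> int) set \<Rightarrow> real \<Rightarrow> bool" where
  "has_natural_density d S r \<longleftrightarrow>
     ((\<lambda>B::real. real (card (S \<inter> int_box d B)) / (2 * B) ^ d) \<longlongrightarrow> r) at_top"

end

theory Submission
  imports Defs "HOL-Number_Theory.Cong" "HOL-Real_Asymp.Real_Asymp"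
begin

text \<open>
  For a fixed prime \<open>p\<close>, whether some integral substitution makes \<open>f\<close> Eisenstein at \<open>p\<close> depends
  only on the coefficients of \<open>f\<close> modulo \<open>p\<^sup>2\<close>. A matrix with determinant divisible by \<open>p\<close> cannot
  produce such a polynomial (\<open>not_dvd_det_of_eisenstein\<close>). If \<open>p\<close> does not divide the determinant,
  then \<open>f\<close> is modulo \<open>p\<close> a constant times the \<open>n\<close>-th power of a linear form, which has a single
  root on the projective line over the field with \<open>p\<close> elements. Moving that root to \<open>0\<close> is all that
  matters, so the \<open>p\<close> shifts \<open>x + t\<close> and the reversal of the coefficients are the only
  substitutions to test (\<open>eisenstein_transform_imp_loc\<close>). The root is determined by \<open>f\<close>, so these \<open>p + 1\<close> cases
  exclude each other, and each substitution permutes the residue vectors modulo \<open>p\<^sup>2\<close>. Hence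
  each case has the probability \<open>(p - 1)\<^sup>2 / p^(n + 2)\<close> of the Eisenstein condition itself
  (\<open>card_loc_affine_eisenstein_residues\<close>).
  
  By the Chinese remainder theorem, finitely many primes act independently, and a set that is
  periodic modulo \<open>N\<close> has as density its proportion of residue vectors. This gives the partial
  products (\<open>tendsto_avoiding_primes_density\<close>).
  
  It remains to bound, uniformly in the size \<open>B\<close> of the box, the contribution of all primes above
  \<open>M\<close>. An \<open>n\<close>-th power of a linear form lies on the cone over the rational normal curve, so its four
  leading coefficients \<open>u, v, w, z\<close> satisfy two quadratic equations, hence congruences modulo \<open>p\<close>. For
  \<open>p \<le> B\<close> they leave \<open>O(B\<^sup>4 / p\<^sup>2)\<close> of the quadruples in the box, which is summable over \<open>p\<close>.
  For \<open>p > B\<close>, the first quadric is an integer of size \<open>O(B\<^sup>2)\<close> in \<open>u, v, w\<close>. It is rarely zero, and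
  if it is nonzero, a bounded number of such primes divide it, each of which leaves a bounded number of
  values of \<open>z\<close>; all these primes together account for \<open>O(B\<^sup>3)\<close> quadruples. So
  the proportion of vectors affected by primes above \<open>M\<close> is \<open>O(1 / M)\<close> as soon as \<open>B \<ge> M\<close>
  (\<open>loc_affine_eisenstein_tail\<close>). Letting first \<open>B\<close> and then \<open>M\<close> tend to infinity proves the claim.
\<close>

section \<open>Substitution into binary forms\<close>

text \<open>
  The binary form of degree \<open>n\<close> with coefficients \<open>\<alpha>\<close>, evaluated at the pair \<open>(P, Q)\<close>. It takes
  a coefficient function instead of a polynomial, so that it applies directly to integer vectors, to
  residue vectors and to forms whose leading coefficient vanishes.
\<close>

definition hom_subst :: "nat \<Rightarrow> (nat \<Rightarrow> int) \<Rightarrow> int poly \<Rightarrow> int poly \<Rightarrow> int poly" where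
  "hom_subst n \<alpha> P Q = (\<Sum>i\<le>n. smult (\<alpha> i) (P ^ i * Q ^ (n - i)))"

lemma degree_linear_powers_le:
  fixes a b c d :: int
  shows "degree ([:b, a:] ^ i * [:d, c:] ^ j) \<le> i + j"
proof -
  have "degree ([:v, u:] ^ k) \<le> k" for u v :: int and k
    using degree_power_le[of "[:v, u:]" k] by (simp split: if_splits)
  note linear = this
  show ?thesis
    by (rule order_trans[OF degree_mult_le add_mono[OF linear linear]])
qed

lemma degree_hom_subst_linear: "degree (hom_subst n \<alpha> [:b, a:] [:d, c:]) \<le> n"
  unfolding hom_subst_def
proof (rule degree_sum_le)
  fix i assume "i \<in> {..n}"
  then show "degree (smult (\<alpha> i) ([:b, a:] ^ i * [:d, c:] ^ (n - i))) \<le> n"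
    using degree_smult_le[of "\<alpha> i" "[:b, a:] ^ i * [:d, c:] ^ (n - i)"]
      degree_linear_powers_le[where i = i and j = "n - i" and a = a and b = b and c = c and d = d] by simp
qed simp

lemma hom_subst_add: "hom_subst n (\<lambda>i. \<alpha> i + \<beta> i) P Q = hom_subst n \<alpha> P Q + hom_subst n \<beta> P Q"
  unfolding hom_subst_def by (simp add: smult_add_left sum.distrib)

lemma smult_sum_right: "smult k (\<Sum>i\<in>S. f i) = (\<Sum>i\<in>S. smult k (f i))"
  by (induction S rule: infinite_finite_induct) (simp_all add: smult_add_right)

lemma hom_subst_scale: "hom_subst n (\<lambda>i. k * \<alpha> i) P Q = smult k (hom_subst n \<alpha> P Q)"
  unfolding hom_subst_def by (simp add: smult_sum_right)

lemma hom_subst_sum: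
  "finite S \<Longrightarrow> hom_subst n (\<lambda>i. \<Sum>k\<in>S. \<alpha> k i) P Q = (\<Sum>k\<in>S. hom_subst n (\<alpha> k) P Q)"
  by (induction S rule: finite_induct) (auto simp: hom_subst_add hom_subst_def)

text \<open>
  Homogeneous substitution is multiplicative when the nominal degrees are added; splitting off one
  linear factor at a time suffices for products of powers of two linear forms.
\<close>

lemma hom_subst_linear_mult:
  assumes "degree h \<le> m"
  shows "hom_subst (Suc m) (coeff ([:b, a:] * h)) P Q
       = (smult a P + smult b Q) * hom_subst m (coeff h) P Q"
proof -
  have "coeff h (Suc m) = 0" using assms by (simp add: coeff_eq_0)
  then have Q: "hom_subst (Suc m) (coeff h) P Q = Q * hom_subst m (coeff h) P Q"
    unfolding hom_subst_def
    by (simp add: sum_distrib_left Suc_diff_le mult.left_commute)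
  have P: "hom_subst (Suc m) (coeff (pCons 0 h)) P Q = P * hom_subst m (coeff h) P Q"
    unfolding hom_subst_def sum.atMost_Suc_shift
    by (simp add: sum_distrib_left mult.assoc)
  have "coeff ([:b, a:] * h) = (\<lambda>i. a * coeff (pCons 0 h) i + b * coeff h i)"
    by (rule ext) (simp add: coeff_pCons split: nat.split)
  then show ?thesis
    by (simp add: hom_subst_add hom_subst_scale P Q distrib_right)
qed

lemma hom_subst_prod_powers:
  "hom_subst (i + j) (coeff ([:b, a:] ^ i * [:d, c:] ^ j)) P Q
     = (smult a P + smult b Q) ^ i * (smult c P + smult d Q) ^ j"
proof (induction i)
  case 0
  show ?case
  proof (induction j)
    case 0 show ?case by (simp add: hom_subst_def)
  next
    case (Suc j)
    have "degree ([:d, c:] ^ j) \<le> j"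
      using degree_linear_powers_le[where i = 0 and j = j and c = c and d = d] by simp
    from hom_subst_linear_mult[OF this, of d c P Q] Suc show ?case
      by (simp only: power_Suc power_0 mult_1_left add_0 add_0_left)
  qed
next
  case (Suc i)
  have "degree ([:b, a:] ^ i * [:d, c:] ^ j) \<le> i + j" by (rule degree_linear_powers_le)
  from hom_subst_linear_mult[OF this, of b a P Q] Suc show ?case
    by (simp only: power_Suc mult.assoc add_Suc)
qed

text \<open>
  The right action of two-by-two matrices on binary forms is associative. This allows a substitution
  to be undone, up to a power of the determinant, by the adjugate matrix.
\<close>

lemma hom_subst_compose:
  "hom_subst n (coeff (hom_subst n \<alpha> [:b, a:] [:d, c:])) P Q
     = hom_subst n \<alpha> (smult a P + smult b Q) (smult c P + smult d Q)"
proof -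
  have "coeff (hom_subst n \<alpha> [:b, a:] [:d, c:])
      = (\<lambda>i. \<Sum>k\<le>n. \<alpha> k * coeff ([:b, a:] ^ k * [:d, c:] ^ (n - k)) i)"
    by (rule ext) (simp add: hom_subst_def coeff_sum)
  then have "hom_subst n (coeff (hom_subst n \<alpha> [:b, a:] [:d, c:])) P Q
     = (\<Sum>k\<le>n. smult (\<alpha> k) (hom_subst n (coeff ([:b, a:] ^ k * [:d, c:] ^ (n - k))) P Q))"
    by (simp add: hom_subst_sum hom_subst_scale)
  also have "\<dots> = (\<Sum>k\<le>n. smult (\<alpha> k)
      ((smult a P + smult b Q) ^ k * (smult c P + smult d Q) ^ (n - k)))"
  proof (rule sum.cong)
    fix k assume "k \<in> {..n}"
    then have "k + (n - k) = n" by simp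
    then show "smult (\<alpha> k) (hom_subst n (coeff ([:b, a:] ^ k * [:d, c:] ^ (n - k))) P Q) =
      smult (\<alpha> k) ((smult a P + smult b Q) ^ k * (smult c P + smult d Q) ^ (n - k))"
      using hom_subst_prod_powers[of k "n - k" b a d c P Q] by simp
  qed simp
  finally show ?thesis by (simp add: hom_subst_def)
qed

lemma hom_subst_scalar_matrix:
  "hom_subst n \<alpha> (smult D P) (smult D Q) = smult (D ^ n) (hom_subst n \<alpha> P Q)"
proof -
  have "smult D P ^ i * smult D Q ^ (n - i) = smult (D ^ n) (P ^ i * Q ^ (n - i))" if "i \<le> n" for i
    using that by (simp add: smult_power power_add[symmetric])
  then show ?thesis unfolding hom_subst_def by (simp add: smult_sum_right mult.commute)
qed

lemma hom_subst_mod_cong: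
  assumes "\<And>i. i \<le> n \<Longrightarrow> [\<alpha> i = \<beta> i] (mod m)"
  shows "[coeff (hom_subst n \<alpha> P Q) k = coeff (hom_subst n \<beta> P Q) k] (mod m)"
  unfolding hom_subst_def coeff_sum using assms by (intro cong_sum) (auto intro: cong_mult)

text \<open>
  If all coefficients except \<open>\<alpha> n\<close> vanish modulo \<open>p\<close>, only the pure power \<open>P ^ n\<close> survives.
\<close>

lemma hom_subst_cong_lead:
  assumes "\<And>i. i < n \<Longrightarrow> p dvd \<alpha> i"
  shows "[coeff (hom_subst n \<alpha> P Q) k = \<alpha> n * coeff (P ^ n) k] (mod p)"
proof -
  have "[coeff (hom_subst n \<alpha> P Q) k = coeff (hom_subst n (\<lambda>i. if i = n then \<alpha> n else 0) P Q) k] (mod p)"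
    using assms by (intro hom_subst_mod_cong) (auto simp: cong_0_iff)
  also have "hom_subst n (\<lambda>i. if i = n then \<alpha> n else 0) P Q
      = (\<Sum>i\<le>n. if i = n then smult (\<alpha> n) (P ^ n) else 0)"
    unfolding hom_subst_def by (intro sum.cong) auto
  also have "\<dots> = smult (\<alpha> n) (P ^ n)"
    by simp
  finally show ?thesis by simp
qed

lemma coeff_0_hom_subst:
  "coeff (hom_subst n \<alpha> [:b, a:] [:d, c:]) 0 = (\<Sum>i\<le>n. \<alpha> i * (b ^ i * d ^ (n - i)))"
  unfolding hom_subst_def coeff_sum by (simp add: coeff_0_power coeff_mult_0)

section \<open>Eisenstein forms at a prime under substitution\<close>

definition eisenstein_vec :: "int \<Rightarrow> nat \<Rightarrow> (nat \<Rightarrow> int) \<Rightarrow> bool" where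
  "eisenstein_vec p n \<alpha> \<longleftrightarrow> \<not> p dvd \<alpha> n \<and> (\<forall>i<n. p dvd \<alpha> i) \<and> \<not> p\<^sup>2 dvd \<alpha> 0"

lemma eisenstein_vec_cong:
  assumes "\<And>i. i \<le> n \<Longrightarrow> [\<alpha> i = \<beta> i] (mod p\<^sup>2)"
  shows "eisenstein_vec p n \<alpha> \<longleftrightarrow> eisenstein_vec p n \<beta>"
proof -
  have "p dvd \<alpha> i \<longleftrightarrow> p dvd \<beta> i" if "i \<le> n" for i
    using assms[OF that] by (meson cong_dvd_iff cong_dvd_modulus dvd_triv_left power2_eq_square dvd_power zero_less_numeral)
  moreover have "p\<^sup>2 dvd \<alpha> 0 \<longleftrightarrow> p\<^sup>2 dvd \<beta> 0"
    using assms[of 0] cong_dvd_iff by auto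
  ultimately show ?thesis unfolding eisenstein_vec_def by auto
qed

text \<open>
  Being Eisenstein at \<open>p\<close> says that the form is a constant times \<open>x ^ n\<close> modulo \<open>p\<close> and that its
  value at the root \<open>(0, 1)\<close> is nonzero modulo \<open>p\<^sup>2\<close>. A substitution that fixes this root modulo \<open>p\<close>
  keeps the first property. For the second, the terms of the new constant coefficient with \<open>i \<ge> 1\<close>
  contain \<open>b ^ i\<close>: for \<open>i = 1\<close> the second factor \<open>p\<close> comes from \<open>\<beta> 1\<close>, which needs \<open>1 < n\<close>, and
  for \<open>i \<ge> 2\<close> both come from \<open>b ^ i\<close>.
\<close>

lemma eisenstein_vec_hom_subst:
  assumes p: "prime p" and n: "n \<ge> 2" and eis: "eisenstein_vec p n \<beta>"
    and b: "p dvd b" and a: "\<not> p dvd a" and d: "\<not> p dvd d"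
  shows "eisenstein_vec p n (coeff (hom_subst n \<beta> [:b, a:] [:d, c:]))"
proof -
  define g where "g = hom_subst n \<beta> [:b, a:] [:d, c:]"
  have low: "p dvd \<beta> i" if "i < n" for i using eis that by (auto simp: eisenstein_vec_def)
  have top: "\<not> p dvd \<beta> n" and bot: "\<not> p\<^sup>2 dvd \<beta> 0" using eis by (auto simp: eisenstein_vec_def)
  have lead: "[coeff g i = \<beta> n * (of_nat (n choose i) * a ^ i * b ^ (n - i))] (mod p)"
    if "i \<le> n" for i
    using hom_subst_cong_lead[of n p \<beta> "[:b, a:]" "[:d, c:]" i] low coeff_linear_poly_power[OF that, of b a]
    by (simp add: g_def)
  have "\<not> p dvd coeff g n"
    using lead[of n] top a p by (auto simp: cong_dvd_iff prime_dvd_mult_iff dest: prime_dvd_power)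
  moreover have "p dvd coeff g i" if "i < n" for i
    using lead[of i] that b by (auto simp: cong_dvd_iff dvd_power_iff intro!: dvd_mult dvd_trans[OF b dvd_power])
  moreover have "\<not> p\<^sup>2 dvd coeff g 0"
  proof -
    have "p\<^sup>2 dvd (\<Sum>i\<in>{..n}-{0}. \<beta> i * (b ^ i * d ^ (n - i)))"
    proof (rule dvd_sum)
      fix i assume i: "i \<in> {..n} - {0}"
      show "p\<^sup>2 dvd \<beta> i * (b ^ i * d ^ (n - i))"
      proof (cases "i = 1")
        case True
        then have "p * p dvd \<beta> i * (b ^ i)" using low[of i] n b by (intro mult_dvd_mono) auto
        then show ?thesis by (simp add: power2_eq_square dvd_mult2 flip: mult.assoc)
      next
        case False
        then have "b\<^sup>2 dvd b ^ i" using i by (intro le_imp_power_dvd) auto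
        then have "p\<^sup>2 dvd b ^ i" using b dvd_power_same dvd_trans by blast
        then show ?thesis by (simp add: dvd_mult dvd_mult2)
      qed
    qed
    moreover have "coeff g 0 = \<beta> 0 * d ^ n + (\<Sum>i\<in>{..n}-{0}. \<beta> i * (b ^ i * d ^ (n - i)))"
      unfolding g_def coeff_0_hom_subst by (subst sum.remove[of _ 0]) auto
    moreover have "\<not> p\<^sup>2 dvd \<beta> 0 * d ^ n"
    proof -
      have "coprime (p\<^sup>2) (d ^ n)" using p d by (simp add: prime_imp_coprime)
      then show ?thesis using bot by (simp add: coprime_dvd_mult_left_iff)
    qed
    ultimately show ?thesis by (simp add: dvd_add_left_iff)
  qed
  ultimately show ?thesis by (simp add: eisenstein_vec_def g_def)
qed

lemma eisenstein_vec_unscale: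
  assumes p: "prime p" and "\<not> p dvd D" and "eisenstein_vec p n (\<lambda>i. D * \<alpha> i)"
  shows "eisenstein_vec p n \<alpha>"
  using assms by (auto simp: eisenstein_vec_def prime_dvd_mult_iff)

text \<open>
  Substituting the adjugate matrix into \<open>\<beta>\<close> gives a multiple of the \<open>n\<close>-th power of the determinant. If
  \<open>p\<close> divided the determinant, it would divide every coefficient of \<open>[:-b, d:] ^ n\<close>, hence \<open>b\<close> and \<open>d\<close>. The
  constant coefficient \<open>\<beta> 0\<close> is homogeneous of degree \<open>n \<ge> 2\<close> in \<open>b\<close> and \<open>d\<close>, so \<open>p\<^sup>2\<close> would divide it.
\<close>

lemma not_dvd_det_of_eisenstein:
  assumes p: "prime p" and n: "n \<ge> 2"
    and eis: "eisenstein_vec p n (coeff (hom_subst n \<alpha> [:b, a:] [:d, c:]))"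
  shows "\<not> p dvd a * d - b * c"
proof
  assume D: "p dvd a * d - b * c"
  define \<beta> where "\<beta> = coeff (hom_subst n \<alpha> [:b, a:] [:d, c:])"
  have eq: "hom_subst n \<beta> [:-b, d:] [:a, -c:] = smult ((a * d - b * c) ^ n) (hom_subst n \<alpha> [:0,1:] [:1:])"
    unfolding \<beta>_def hom_subst_compose
    by (simp flip: hom_subst_scalar_matrix add: algebra_simps)
  have "p dvd coeff (hom_subst n \<beta> [:-b, d:] [:a, -c:]) k" for k
    unfolding eq using D n by (simp add: dvd_mult2 dvd_trans[OF D dvd_power])
  moreover have "[coeff (hom_subst n \<beta> [:-b, d:] [:a, -c:]) k = \<beta> n * coeff ([:-b, d:] ^ n) k] (mod p)" for k
    using eis by (intro hom_subst_cong_lead) (auto simp: eisenstein_vec_def \<beta>_def)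
  ultimately have "p dvd \<beta> n * coeff ([:-b, d:] ^ n) k" for k
    using cong_dvd_iff by blast
  then have *: "p dvd coeff ([:-b, d:] ^ n) k" for k
    using eis p by (metis \<beta>_def eisenstein_vec_def prime_dvd_mult_iff)
  have "p dvd b" using *[of 0] p by (auto simp: coeff_0_power dest: prime_dvd_power)
  moreover have "p dvd d" using *[of n] p by (auto simp: coeff_linear_poly_power dest: prime_dvd_power)
  ultimately have "p\<^sup>2 dvd b ^ i * d ^ (n - i)" if "i \<le> n" for i
    using mult_dvd_mono[OF dvd_power_same[of p b i] dvd_power_same[of p d "n - i"]] that n
    by (auto simp flip: power_add intro: dvd_trans[OF le_imp_power_dvd])
  then have "p\<^sup>2 dvd \<beta> 0"
    unfolding \<beta>_def coeff_0_hom_subst by (intro dvd_sum) (auto intro: dvd_mult)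
  then show False using eis by (simp add: eisenstein_vec_def \<beta>_def)
qed

text \<open>
  Each of the \<open>p + 1\<close> points of the projective line over the field with \<open>p\<close> elements is represented by
  one substitution that moves it to \<open>0\<close>: the point at infinity by the reversal, \<open>t\<close> by the shift.
\<close>

definition loc_affine_eisenstein :: "nat \<Rightarrow> int \<Rightarrow> (nat \<Rightarrow> int) \<Rightarrow> bool" where
  "loc_affine_eisenstein n p \<alpha> \<longleftrightarrow>
     eisenstein_vec p n (coeff (hom_subst n \<alpha> [:1:] [:0, 1:])) \<or>
     (\<exists>t\<in>{0..<p}. eisenstein_vec p n (coeff (hom_subst n \<alpha> [:t, 1:] [:1:])))"

lemma loc_affine_eisenstein_cong:
  assumes "\<And>i. i \<le> n \<Longrightarrow> [\<alpha> i = \<beta> i] (mod p\<^sup>2)"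
  shows "loc_affine_eisenstein n p \<alpha> \<longleftrightarrow> loc_affine_eisenstein n p \<beta>"
proof -
  have "eisenstein_vec p n (coeff (hom_subst n \<alpha> P Q)) \<longleftrightarrow> eisenstein_vec p n (coeff (hom_subst n \<beta> P Q))" for P Q
    using assms by (intro eisenstein_vec_cong hom_subst_mod_cong)
  then show ?thesis unfolding loc_affine_eisenstein_def by simp
qed

text \<open>
  Undo the given substitution with the adjugate matrix and then apply the representative of the root
  \<open>b / d\<close>. The combined matrix fixes \<open>0\<close> modulo \<open>p\<close>, so it preserves the Eisenstein property, and the
  result is \<open>\<alpha>\<close> under the representative, up to the unit \<open>D ^ n\<close>.
\<close>

lemma eisenstein_transform_imp_loc:
  assumes p: "prime p" and n: "n \<ge> 2"
    and eis: "eisenstein_vec p n (coeff (hom_subst n \<alpha> [:b, a:] [:d, c:]))"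
  shows "loc_affine_eisenstein n p \<alpha>"
proof -
  define D where "D = a * d - b * c"
  have D: "\<not> p dvd D" unfolding D_def by (rule not_dvd_det_of_eisenstein[OF p n eis])
  have Dn: "\<not> p dvd D ^ n" using D p by (auto dest: prime_dvd_power)
  define \<beta> where "\<beta> = coeff (hom_subst n \<alpha> [:b, a:] [:d, c:])"
  show ?thesis
  proof (cases "p dvd d")
    case True
    then have bc: "\<not> p dvd b" "\<not> p dvd c"
      using D unfolding D_def by (auto simp: dvd_diff dvd_mult dvd_mult2)
    \<comment> \<open>The root \<open>b / d\<close> is the point at infinity: the adjugate is composed with the reversal.\<close>
    have "hom_subst n \<beta> [:d, -b:] [:-c, a:] = smult (D ^ n) (hom_subst n \<alpha> [:1:] [:0, 1:])"
      unfolding \<beta>_def hom_subst_compose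
      by (simp flip: hom_subst_scalar_matrix add: algebra_simps D_def)
    moreover have "eisenstein_vec p n (coeff (hom_subst n \<beta> [:d, -b:] [:-c, a:]))"
      using eis True bc p n by (intro eisenstein_vec_hom_subst) (auto simp: \<beta>_def)
    ultimately have "eisenstein_vec p n (\<lambda>i. D ^ n * coeff (hom_subst n \<alpha> [:1:] [:0, 1:]) i)"
      by (simp add: eisenstein_vec_def)
    from eisenstein_vec_unscale[OF p Dn this] show ?thesis by (simp add: loc_affine_eisenstein_def)
  next
    case False
    then have "coprime d p" using p by (metis coprime_commute prime_imp_coprime)
    then obtain e where e: "[d * e = 1] (mod p)" using cong_solve_coprime_int by blast
    define t where "t = (e * b) mod p"
    have "[d * t = d * (e * b)] (mod p)" unfolding t_def by (intro cong_mult) (auto simp: cong_def)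
    also have "d * (e * b) = (d * e) * b" by simp
    also have "[(d * e) * b = 1 * b] (mod p)" using e by (intro cong_mult) auto
    finally have t: "p dvd d * t - b" by (simp add: cong_iff_dvd_diff)
    have "d * (a - c * t) = D - c * (d * t - b)" by (simp add: D_def algebra_simps)
    then have ac: "\<not> p dvd a - c * t" using D t by (metis dvd_diff_left_iff dvd_mult dvd_mult_right)
    \<comment> \<open>The matrix here is the adjugate composed with the shift by \<open>t\<close>.\<close>
    have "hom_subst n \<beta> [:d * t - b, d:] [:a - c * t, -c:] = smult (D ^ n) (hom_subst n \<alpha> [:t, 1:] [:1:])"
      unfolding \<beta>_def hom_subst_compose
      by (simp flip: hom_subst_scalar_matrix add: algebra_simps D_def)
    moreover have "eisenstein_vec p n (coeff (hom_subst n \<beta> [:d * t - b, d:] [:a - c * t, -c:]))"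
      using eis t ac False p n by (intro eisenstein_vec_hom_subst) (auto simp: \<beta>_def)
    ultimately have "eisenstein_vec p n (\<lambda>i. D ^ n * coeff (hom_subst n \<alpha> [:t, 1:] [:1:]) i)"
      by (simp add: eisenstein_vec_def)
    from eisenstein_vec_unscale[OF p Dn this]
    show ?thesis using p by (auto simp: loc_affine_eisenstein_def t_def prime_gt_0_int)
  qed
qed

lemma coeff_hom_subst_id: "i \<le> n \<Longrightarrow> coeff (hom_subst n \<alpha> [:0, 1:] [:1:]) i = \<alpha> i"
proof -
  have "hom_subst n \<alpha> [:0, 1:] [:1:] = (\<Sum>i\<le>n. monom (\<alpha> i) i)"
    unfolding hom_subst_def by (intro sum.cong) (simp_all add: monom_altdef poly_const_pow pCons_one)
  then show "i \<le> n \<Longrightarrow> ?thesis" by (simp add: coeff_sum)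
qed

text \<open>
  Undoing the representative turns \<open>x ^ n\<close> into \<open>(a x + b) ^ n\<close>, so the coefficients are binomial
  modulo \<open>p\<close>.
\<close>

lemma loc_affine_eisenstein_cong_power:
  assumes loc: "loc_affine_eisenstein n p \<alpha>"
  obtains \<beta> a b where "\<And>i. i \<le> n \<Longrightarrow> [\<alpha> i = \<beta> * (of_nat (n choose i) * a ^ i * b ^ (n - i))] (mod p)"
proof -
  note witness = that
  have main: thesis if eis: "eisenstein_vec p n (coeff (hom_subst n \<alpha> P Q))"
    and inv: "hom_subst n (coeff (hom_subst n \<alpha> P Q)) [:b, a:] [:d, c:] = hom_subst n \<alpha> [:0, 1:] [:1:]"
    for P Q a b c d
  proof (rule witness)
    fix i assume i: "i \<le> n"
    have "[coeff (hom_subst n (coeff (hom_subst n \<alpha> P Q)) [:b, a:] [:d, c:]) i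
        = coeff (hom_subst n \<alpha> P Q) n * coeff ([:b, a:] ^ n) i] (mod p)"
      using eis by (intro hom_subst_cong_lead) (auto simp: eisenstein_vec_def)
    then show "[\<alpha> i = coeff (hom_subst n \<alpha> P Q) n * (of_nat (n choose i) * a ^ i * b ^ (n - i))] (mod p)"
      by (simp only: inv coeff_hom_subst_id[OF i] coeff_linear_poly_power[OF i])
  qed
  from loc show thesis unfolding loc_affine_eisenstein_def
  proof (elim disjE bexE)
    assume "eisenstein_vec p n (coeff (hom_subst n \<alpha> [:1:] [:0, 1:]))"
    from main[OF this, where a = 0 and b = 1 and c = 1 and d = 0]
    show thesis using hom_subst_compose[of n \<alpha> 1 0 0 1 "[:1:]" "[:0, 1:]"] by simp
  next
    fix t assume "eisenstein_vec p n (coeff (hom_subst n \<alpha> [:t, 1:] [:1:]))"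
    from main[OF this, where a = 1 and b = "-t" and c = 0 and d = 1]
    show thesis using hom_subst_compose[of n \<alpha> t 1 1 0 "[:-t, 1:]" "[:1:]"] by simp
  qed
qed

text \<open>
  These are two of the equations of the cone over the rational normal curve, multiplied through so that
  they have integer coefficients. The first one expresses \<open>\<alpha> (n - 2)\<close> and the second one \<open>\<alpha> (n - 3)\<close> modulo
  \<open>p\<close>, provided that the prime \<open>p\<close> exceeds \<open>3 n\<close> and does not divide \<open>\<alpha> n\<close>.
\<close>

lemma loc_affine_eisenstein_quadrics:
  assumes n: "n \<ge> 3" and loc: "loc_affine_eisenstein n p \<alpha>"
  shows "p dvd (int n - 1) * (\<alpha> (n - 1))\<^sup>2 - 2 * int n * \<alpha> n * \<alpha> (n - 2)"
    and "p dvd (int n - 2) * \<alpha> (n - 1) * \<alpha> (n - 2) - 3 * int n * \<alpha> n * \<alpha> (n - 3)"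
proof -
  obtain m where m: "n = m + 3" using n le_Suc_ex by (metis add.commute)
  obtain \<beta> a b where cong: "\<And>i. i \<le> n \<Longrightarrow> [\<alpha> i = \<beta> * (of_nat (n choose i) * a ^ i * b ^ (n - i))] (mod p)"
    by (rule loc_affine_eisenstein_cong_power[OF loc]) blast
  define C2 C3 :: int where "C2 = of_nat (n choose 2)" and "C3 = of_nat (n choose 3)"
  have c2: "2 * C2 = int n * (int n - 1)"
  proof -
    have "2 * (n choose 2) = n * (n - 1)" using n by (cases n) (simp_all add: choose_two)
    from arg_cong[OF this, of int] show ?thesis using n by (simp add: C2_def of_nat_diff)
  qed
  have c3: "3 * C3 = (int n - 2) * C2"
  proof -
    have "3 * (n choose 3) = (n - 2) * (n choose 2)"
      using binomial_absorb_comp[of n 2] binomial_absorption[of 2 "n"] Suc_times_binomial_add[of 2 m] by (simp add: m numeral_3_eq_3 numeral_2_eq_2)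
    from arg_cong[OF this, of int] show ?thesis using n by (simp add: C2_def C3_def of_nat_diff)
  qed
  have a0: "[\<alpha> n = \<beta> * a ^ n] (mod p)" using cong[of n] by simp
  have a1: "[\<alpha> (n - 1) = \<beta> * (int n * a ^ (n - 1) * b)] (mod p)"
    using cong[of "n - 1"] n binomial_symmetric[of 1 n] by simp
  have a2: "[\<alpha> (n - 2) = \<beta> * (C2 * a ^ (n - 2) * b\<^sup>2)] (mod p)"
    using cong[of "n - 2"] n binomial_symmetric[of 2 n] by (simp add: C2_def)
  have a3: "[\<alpha> (n - 3) = \<beta> * (C3 * a ^ (n - 3) * b ^ 3)] (mod p)"
    using cong[of "n - 3"] n binomial_symmetric[of 3 n] by (simp add: C3_def)
  have "[(int n - 1) * (\<alpha> (n - 1))\<^sup>2 - 2 * int n * \<alpha> n * \<alpha> (n - 2) =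
      (int n - 1) * (\<beta> * (int n * a ^ (n - 1) * b))\<^sup>2 - 2 * int n * (\<beta> * a ^ n) * (\<beta> * (C2 * a ^ (n - 2) * b\<^sup>2))] (mod p)"
    by (intro cong_diff cong_mult cong_pow a0 a1 a2 cong_refl)
  also have "(int n - 1) * (\<beta> * (int n * a ^ (n - 1) * b))\<^sup>2 - 2 * int n * (\<beta> * a ^ n) * (\<beta> * (C2 * a ^ (n - 2) * b\<^sup>2))
      = \<beta>\<^sup>2 * int n * a ^ (2 * m + 4) * b\<^sup>2 * (int n * (int n - 1) - 2 * C2)"
    by (simp add: m power_add power2_eq_square power_mult algebra_simps eval_nat_numeral power_mult_distrib)
  finally show "p dvd (int n - 1) * (\<alpha> (n - 1))\<^sup>2 - 2 * int n * \<alpha> n * \<alpha> (n - 2)"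
    using c2 by (simp add: cong_0_iff)
  have "[(int n - 2) * \<alpha> (n - 1) * \<alpha> (n - 2) - 3 * int n * \<alpha> n * \<alpha> (n - 3) =
      (int n - 2) * (\<beta> * (int n * a ^ (n - 1) * b)) * (\<beta> * (C2 * a ^ (n - 2) * b\<^sup>2))
       - 3 * int n * (\<beta> * a ^ n) * (\<beta> * (C3 * a ^ (n - 3) * b ^ 3))] (mod p)"
    by (intro cong_diff cong_mult cong_pow a0 a1 a2 a3 cong_refl)
  also have "(int n - 2) * (\<beta> * (int n * a ^ (n - 1) * b)) * (\<beta> * (C2 * a ^ (n - 2) * b\<^sup>2))
       - 3 * int n * (\<beta> * a ^ n) * (\<beta> * (C3 * a ^ (n - 3) * b ^ 3))
      = \<beta>\<^sup>2 * int n * a ^ (2 * m + 3) * b ^ 3 * ((int n - 2) * C2 - 3 * C3)"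
    by (simp add: m power_add power2_eq_square power_mult algebra_simps eval_nat_numeral power_mult_distrib)
  finally show "p dvd (int n - 2) * \<alpha> (n - 1) * \<alpha> (n - 2) - 3 * int n * \<alpha> n * \<alpha> (n - 3)"
    using c3 by (simp add: cong_0_iff)
qed

text \<open>
  This makes the requirement that the degree is exactly \<open>n\<close> automatic: under a shift the leading
  coefficient is a unit modulo \<open>p\<close>, under the reversal it becomes a constant coefficient that is
  nonzero modulo \<open>p\<^sup>2\<close>.
\<close>

lemma loc_affine_eisenstein_lead_nonzero:
  assumes loc: "loc_affine_eisenstein n p \<alpha>"
  shows "\<alpha> n \<noteq> 0"
  using loc unfolding loc_affine_eisenstein_def
proof (elim disjE bexE)
  assume "eisenstein_vec p n (coeff (hom_subst n \<alpha> [:1:] [:0, 1:]))"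
  moreover have "coeff (hom_subst n \<alpha> [:1:] [:0, 1:]) 0 = (\<Sum>i\<le>n. if i = n then \<alpha> i else 0)"
    using coeff_0_hom_subst[of n \<alpha> 1 0 0 1] by (auto intro!: sum.cong simp: power_0_left simp del: sum.delta sum.delta')
  ultimately show ?thesis by (auto simp: eisenstein_vec_def)
next
  fix t assume eis: "eisenstein_vec p n (coeff (hom_subst n \<alpha> [:t, 1:] [:1:]))"
  define g where "g = coeff (hom_subst n \<alpha> [:t, 1:] [:1:])"
  have "hom_subst n g [:-t, 1:] [:1:] = hom_subst n \<alpha> [:0, 1:] [:1:]"
    using hom_subst_compose[of n \<alpha> t 1 1 0 "[:-t, 1:]" "[:1:]"] by (simp add: g_def)
  moreover have "[coeff (hom_subst n g [:-t, 1:] [:1:]) n = g n * coeff ([:-t, 1:] ^ n) n] (mod p)"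
    using eis by (intro hom_subst_cong_lead) (auto simp: eisenstein_vec_def g_def)
  ultimately have "[\<alpha> n = g n] (mod p)"
    by (simp add: coeff_hom_subst_id coeff_linear_poly_power)
  then show ?thesis using eis by (auto simp: eisenstein_vec_def g_def cong_dvd_iff cong_0_iff dest: cong_sym)
qed

lemma affine_eisenstein_polys_iff:
  assumes n: "n \<ge> 2"
  shows "f \<in> affine_eisenstein_polys n \<longleftrightarrow>
    degree f = n \<and> (\<exists>p::nat. prime p \<and> loc_affine_eisenstein n (int p) (coeff f))"
proof -
  have tr: "affine_transform n f A = hom_subst n (coeff f) [:A$1$2, A$1$1:] [:A$2$2, A$2$1:]" for A
    by (simp add: affine_transform_def hom_subst_def)
  have eis: "g \<in> eisenstein_polys n \<longleftrightarrow> (\<exists>p::nat. prime p \<and> eisenstein_vec (int p) n (coeff g))"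
    if "degree g \<le> n" for g
  proof -
    have "degree g = n" if "eisenstein_vec (int p) n (coeff g)" for p
      using \<open>degree g \<le> n\<close> that le_degree[of g n] by (force simp: eisenstein_vec_def)
    then show ?thesis
      by (auto simp: eisenstein_polys_def eisenstein_at_def eisenstein_vec_def)
  qed
  have "(\<exists>A. affine_transform n f A \<in> eisenstein_polys n) \<longleftrightarrow>
      (\<exists>p::nat. prime p \<and> (\<exists>A::int^2^2. eisenstein_vec (int p) n (coeff (affine_transform n f A))))"
    by (auto simp: eis tr degree_hom_subst_linear)
  also have "\<dots> \<longleftrightarrow> (\<exists>p::nat. prime p \<and> loc_affine_eisenstein n (int p) (coeff f))"
  proof (intro iff_exI conj_cong refl iffI)
    fix p :: nat assume p: "prime p"
    assume "\<exists>A::int^2^2. eisenstein_vec (int p) n (coeff (affine_transform n f A))"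
    then show "loc_affine_eisenstein n (int p) (coeff f)"
      using eisenstein_transform_imp_loc[of "int p" n] p n by (auto simp: tr)
  next
    fix p :: nat
    assume "loc_affine_eisenstein n (int p) (coeff f)"
    then obtain b a d c where "eisenstein_vec (int p) n (coeff (hom_subst n (coeff f) [:b, a:] [:d, c:]))"
      unfolding loc_affine_eisenstein_def by (metis pCons_0_0)
    then show "\<exists>A::int^2^2. eisenstein_vec (int p) n (coeff (affine_transform n f A))"
      by (intro exI[of _ "vector [vector [a, b], vector [c, d]]"]) (simp add: tr)
  qed
  finally show ?thesis by (auto simp: affine_eisenstein_polys_def)
qed

lemma affine_eisenstein_vecs_in_box:
  assumes n: "n \<ge> 2"
  shows "coeff_vec n ` affine_eisenstein_polys n \<inter> int_box (n + 1) B
    = {\<alpha> \<in> int_box (n + 1) B. \<exists>p::nat. prime p \<and> loc_affine_eisenstein n (int p) \<alpha>}"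
proof (intro equalityI subsetI)
  fix \<alpha> assume "\<alpha> \<in> coeff_vec n ` affine_eisenstein_polys n \<inter> int_box (n + 1) B"
  then obtain f p where "\<alpha> = coeff_vec n f" "\<alpha> \<in> int_box (n + 1) B" "prime (p::nat)"
     "loc_affine_eisenstein n (int p) (coeff f)" by (auto simp: affine_eisenstein_polys_iff[OF n])
  moreover have "loc_affine_eisenstein n (int p) (coeff f) \<longleftrightarrow> loc_affine_eisenstein n (int p) (coeff_vec n f)"
    by (intro loc_affine_eisenstein_cong) (simp add: coeff_vec_def)
  ultimately show "\<alpha> \<in> {\<alpha> \<in> int_box (n + 1) B. \<exists>p::nat. prime p \<and> loc_affine_eisenstein n (int p) \<alpha>}"
    by auto
next
  fix \<alpha> assume "\<alpha> \<in> {\<alpha> \<in> int_box (n + 1) B. \<exists>p::nat. prime p \<and> loc_affine_eisenstein n (int p) \<alpha>}"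
  then obtain p where box: "\<alpha> \<in> int_box (n + 1) B" and p: "prime (p::nat)"
    and loc: "loc_affine_eisenstein n (int p) \<alpha>" by auto
  define f where "f = (\<Sum>i\<le>n. monom (\<alpha> i) i)"
  have coeff: "coeff f i = (if i \<le> n then \<alpha> i else 0)" for i
    by (simp add: f_def coeff_sum)
  have "\<alpha> n \<noteq> 0" by (rule loc_affine_eisenstein_lead_nonzero[OF loc])
  then have "degree f = n"
    by (intro antisym degree_le le_degree) (auto simp: coeff)
  moreover have "loc_affine_eisenstein n (int p) (coeff f) \<longleftrightarrow> loc_affine_eisenstein n (int p) \<alpha>"
    by (intro loc_affine_eisenstein_cong) (simp add: coeff)
  moreover have "coeff_vec n f = \<alpha>"
    using box by (auto simp: coeff_vec_def coeff int_box_def PiE_def extensional_def fun_eq_iff)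
  ultimately have "f \<in> affine_eisenstein_polys n" "coeff_vec n f = \<alpha>"
    using loc p affine_eisenstein_polys_iff[OF n, of f] by auto
  then show "\<alpha> \<in> coeff_vec n ` affine_eisenstein_polys n \<inter> int_box (n + 1) B"
    using box by auto
qed

section \<open>Counting residue vectors modulo the square of a prime\<close>

definition residue_vecs :: "nat \<Rightarrow> nat \<Rightarrow> (nat \<Rightarrow> int) set" where
  "residue_vecs d N = {..<d} \<rightarrow>\<^sub>E {0..<int N}"

lemma finite_residue_vecs: "finite (residue_vecs d N)"
  by (simp add: residue_vecs_def finite_PiE)

lemma card_residue_vecs: "card (residue_vecs d N) = N ^ d"
  by (simp add: residue_vecs_def card_PiE)

lemma card_eisenstein_residues:
  assumes p: "prime (p::nat)" and n: "n \<ge> 1"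
  shows "card {r \<in> residue_vecs (n + 1) (p\<^sup>2). eisenstein_vec (int p) n r} = (p - 1)\<^sup>2 * p ^ n"
proof -
  have p0: "p > 0" using p prime_gt_0_nat by simp
  define Ai where "Ai = {k\<in>{0..<int (p\<^sup>2)}. int p dvd k}"
  define An where "An = {k\<in>{0..<int (p\<^sup>2)}. \<not> int p dvd k}"
  define A0 where "A0 = {k\<in>{0..<int (p\<^sup>2)}. int p dvd k \<and> \<not> (int p)\<^sup>2 dvd k}"
  have "Ai = (\<lambda>j. int p * j) ` {0..<int p}"
    using p0 by (auto simp: Ai_def power2_eq_square zero_le_mult_iff elim!: dvdE)
  then have Ai: "card Ai = p" using p0 by (simp add: card_image inj_on_def)
  have fin: "finite Ai" unfolding Ai_def by (rule finite_subset[of _ "{0..<int (p\<^sup>2)}"]) auto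
  have "An = {0..<int (p\<^sup>2)} - Ai" by (auto simp: An_def Ai_def)
  moreover have "Ai \<subseteq> {0..<int (p\<^sup>2)}" by (auto simp: Ai_def)
  ultimately have An: "card An = p\<^sup>2 - p" using fin Ai by (simp add: card_Diff_subset del: of_nat_power)
  have "A0 = Ai - {0}"
    using p0 by (auto simp: A0_def Ai_def dest: zdvd_not_zless zdvd_imp_le)
  then have A0: "card A0 = p - 1" using fin Ai p0 by (simp add: Ai_def)
  define T where "T i = (if i = 0 then A0 else if i = n then An else Ai)" for i
  have "{r \<in> residue_vecs (n + 1) (p\<^sup>2). eisenstein_vec (int p) n r} = PiE {..<n + 1} T"
  proof (intro equalityI subsetI)
    fix r assume "r \<in> {r \<in> residue_vecs (n + 1) (p\<^sup>2). eisenstein_vec (int p) n r}"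
    then have r: "r \<in> residue_vecs (n + 1) (p\<^sup>2)" and eis: "eisenstein_vec (int p) n r" by auto
    have ran: "r i \<in> {0..<int (p\<^sup>2)}" if "i < n + 1" for i
      using that PiE_mem[OF r[unfolded residue_vecs_def], of i] by simp
    have "r i \<in> T i" if "i < n + 1" for i
    proof -
      consider "i = 0" | "i = n" "n > 0" | "0 < i" "i < n" using \<open>i < n + 1\<close> by linarith
      then show ?thesis
        using ran[OF that] eis n by cases (auto simp: eisenstein_vec_def T_def Ai_def An_def A0_def)
    qed
    then show "r \<in> PiE {..<n + 1} T"
      using r unfolding residue_vecs_def PiE_iff by blast
  next
    fix r assume r: "r \<in> PiE {..<n + 1} T"
    then have ri: "r i \<in> T i" if "i \<le> n" for i
      using that PiE_mem[of r "{..<n + 1}" T i] by simp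
    have range: "T i \<subseteq> {0..<int (p\<^sup>2)}" for i
      unfolding T_def Ai_def An_def A0_def by auto
    have low: "T i \<subseteq> {k. int p dvd k}" if "i < n" for i
      using that unfolding T_def Ai_def A0_def by auto
    have "r i \<in> {0..<int (p\<^sup>2)}" if "i \<le> n" for i
      using ri[OF that] range by blast
    moreover have "int p dvd r i" if "i < n" for i
      using ri[of i] low[OF that] that by auto
    moreover have "r n \<in> An" "r 0 \<in> A0" using ri[of n] ri[of 0] n by (auto simp: T_def)
    ultimately show "r \<in> {r \<in> residue_vecs (n + 1) (p\<^sup>2). eisenstein_vec (int p) n r}"
      using r by (auto simp: residue_vecs_def PiE_iff eisenstein_vec_def An_def A0_def)
  qed
  then have "card {r \<in> residue_vecs (n + 1) (p\<^sup>2). eisenstein_vec (int p) n r} = (\<Prod>i<n + 1. card (T i))"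
    by (simp add: card_PiE)
  also have "{..<n + 1} = insert 0 (insert n {1..<n})" using n by auto
  also have "(\<Prod>i\<in>insert 0 (insert n {1..<n}). card (T i)) = (p - 1) * ((p\<^sup>2 - p) * p ^ (n - 1))"
    using n by (simp add: T_def A0 An Ai)
  also have "\<dots> = (p - 1)\<^sup>2 * p ^ n"
  proof -
    have "p\<^sup>2 - p = (p - 1) * p" by (simp add: power2_eq_square diff_mult_distrib)
    moreover have "p ^ n = p * p ^ (n - 1)" using n by (cases n) auto
    ultimately show ?thesis by (simp add: power2_eq_square)
  qed
  finally show ?thesis .
qed

text \<open>
  An invertible substitution permutes the residue vectors modulo \<open>N\<close>, with the inverse
  substitution as inverse permutation.
\<close>

lemma card_eisenstein_transform_residues:
  assumes inv: "smult a [:b', a':] + smult b [:d', c':] = [:0, 1:]" "smult c [:b', a':] + smult d [:d', c':] = [:1:]"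
    and inv': "smult a' [:b, a:] + smult b' [:d, c:] = [:0, 1:]" "smult c' [:b, a:] + smult d' [:d, c:] = [:1:]"
    and N: "int N = p\<^sup>2" "N > 0"
  shows "card {r \<in> residue_vecs (n + 1) N. eisenstein_vec p n (coeff (hom_subst n r [:b, a:] [:d, c:]))}
       = card {r \<in> residue_vecs (n + 1) N. eisenstein_vec p n r}"
proof -
  define tr where "tr P Q r = (\<lambda>i\<in>{..<n + 1}. coeff (hom_subst n r P Q) i mod int N)" for P Q r
  have tr_in: "tr P Q r \<in> residue_vecs (n + 1) N" for P Q r
    using N(2) by (auto simp: tr_def residue_vecs_def)
  have tr_cong: "[tr P Q r i = coeff (hom_subst n r P Q) i] (mod int N)" if "i \<le> n" for P Q r i
    using that by (simp add: tr_def)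
  have tr_tr: "tr [:b2, a2:] [:d2, c2:] (tr [:b1, a1:] [:d1, c1:] r) = r"
    if r: "r \<in> residue_vecs (n + 1) N" and
      inv: "smult a1 [:b2, a2:] + smult b1 [:d2, c2:] = [:0, 1:]" "smult c1 [:b2, a2:] + smult d1 [:d2, c2:] = [:1:]"
    for a1 b1 c1 d1 a2 b2 c2 d2 r
  proof
    fix i show "tr [:b2, a2:] [:d2, c2:] (tr [:b1, a1:] [:d1, c1:] r) i = r i"
    proof (cases "i \<le> n")
      case True
      have "[coeff (hom_subst n (tr [:b1, a1:] [:d1, c1:] r) [:b2, a2:] [:d2, c2:]) i
          = coeff (hom_subst n (coeff (hom_subst n r [:b1, a1:] [:d1, c1:])) [:b2, a2:] [:d2, c2:]) i] (mod int N)"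
        by (intro hom_subst_mod_cong tr_cong)
      also have "coeff (hom_subst n (coeff (hom_subst n r [:b1, a1:] [:d1, c1:])) [:b2, a2:] [:d2, c2:]) i = r i"
        unfolding hom_subst_compose inv using True by (rule coeff_hom_subst_id)
      finally have "tr [:b2, a2:] [:d2, c2:] (tr [:b1, a1:] [:d1, c1:] r) i = r i mod int N"
        using True by (simp add: tr_def[of "[:b2, a2:]"] cong_def)
      also have "r i mod int N = r i" using r True by (auto simp: residue_vecs_def PiE_iff)
      finally show ?thesis .
    next
      case False
      then show ?thesis using r by (auto simp: tr_def residue_vecs_def PiE_iff extensional_def)
    qed
  qed
  have eis_tr: "eisenstein_vec p n (tr P Q r) \<longleftrightarrow> eisenstein_vec p n (coeff (hom_subst n r P Q))" for P Q r
    using tr_cong unfolding N by (rule eisenstein_vec_cong)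
  have "bij_betw (tr [:b, a:] [:d, c:])
     {r \<in> residue_vecs (n + 1) N. eisenstein_vec p n (coeff (hom_subst n r [:b, a:] [:d, c:]))}
     {r \<in> residue_vecs (n + 1) N. eisenstein_vec p n r}"
  proof (rule bij_betw_byWitness[where f' = "tr [:b', a':] [:d', c':]"])
    show "\<forall>r\<in>{r \<in> residue_vecs (n + 1) N. eisenstein_vec p n (coeff (hom_subst n r [:b, a:] [:d, c:]))}.
        tr [:b', a':] [:d', c':] (tr [:b, a:] [:d, c:] r) = r"
      using tr_tr inv by blast
    show "\<forall>r\<in>{r \<in> residue_vecs (n + 1) N. eisenstein_vec p n r}.
        tr [:b, a:] [:d, c:] (tr [:b', a':] [:d', c':] r) = r"
      using tr_tr inv' by blast
    show "tr [:b, a:] [:d, c:] `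
       {r \<in> residue_vecs (n + 1) N. eisenstein_vec p n (coeff (hom_subst n r [:b, a:] [:d, c:]))}
       \<subseteq> {r \<in> residue_vecs (n + 1) N. eisenstein_vec p n r}"
      using tr_in eis_tr by blast
    show "tr [:b', a':] [:d', c':] ` {r \<in> residue_vecs (n + 1) N. eisenstein_vec p n r}
       \<subseteq> {r \<in> residue_vecs (n + 1) N. eisenstein_vec p n (coeff (hom_subst n r [:b, a:] [:d, c:]))}"
      using tr_in eis_tr tr_tr inv' by (auto simp flip: eis_tr)
  qed
  then show ?thesis by (rule bij_betw_same_card)
qed

text \<open>
  Modulo \<open>p\<close> the form is a constant times \<open>(x - s) ^ n\<close>, and its only root is \<open>s\<close>.
\<close>

lemma eisenstein_shift_unique:
  assumes p: "prime p" and st: "s \<in> {0..<p}" "t \<in> {0..<p}" and n: "n \<ge> 1"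
    and s: "eisenstein_vec p n (coeff (hom_subst n \<alpha> [:s, 1:] [:1:]))"
    and t: "eisenstein_vec p n (coeff (hom_subst n \<alpha> [:t, 1:] [:1:]))"
  shows "s = t"
proof -
  define g where "g = coeff (hom_subst n \<alpha> [:s, 1:] [:1:])"
  have "hom_subst n g [:t - s, 1:] [:1:] = hom_subst n \<alpha> [:t, 1:] [:1:]"
    using hom_subst_compose[of n \<alpha> s 1 1 0 "[:t - s, 1:]" "[:1:]"] by (simp add: g_def)
  moreover have "[coeff (hom_subst n g [:t - s, 1:] [:1:]) 0 = g n * coeff ([:t - s, 1:] ^ n) 0] (mod p)"
    using s by (intro hom_subst_cong_lead) (auto simp: eisenstein_vec_def g_def)
  ultimately have "p dvd g n * (t - s) ^ n"
    using t n by (auto simp: eisenstein_vec_def coeff_0_power cong_dvd_iff)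
  then have "p dvd t - s"
    using s p by (auto simp: eisenstein_vec_def g_def prime_dvd_mult_iff dest: prime_dvd_power)
  then show ?thesis using st by (auto simp flip: mod_eq_dvd_iff)
qed

text \<open>
  The shift requires the leading coefficient of the original form to be a unit modulo \<open>p\<close>, whereas the
  reversal requires \<open>p\<close> to divide that coefficient.
\<close>

lemma eisenstein_shift_not_reversal:
  assumes p: "prime p" and n: "n \<ge> 1"
    and t: "eisenstein_vec p n (coeff (hom_subst n \<alpha> [:t, 1:] [:1:]))"
    and rev: "eisenstein_vec p n (coeff (hom_subst n \<alpha> [:1:] [:0, 1:]))"
  shows False
proof -
  define g where "g = coeff (hom_subst n \<alpha> [:t, 1:] [:1:])"
  have "hom_subst n g [:1, -t:] [:0, 1:] = hom_subst n \<alpha> [:1:] [:0, 1:]"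
    using hom_subst_compose[of n \<alpha> t 1 1 0 "[:1, -t:]" "[:0, 1:]"] by (simp add: g_def)
  moreover have "[coeff (hom_subst n g [:1, -t:] [:0, 1:]) 0 = g n * coeff ([:1, -t:] ^ n) 0] (mod p)"
    using t by (intro hom_subst_cong_lead) (auto simp: eisenstein_vec_def g_def)
  ultimately have "p dvd g n"
    using rev n by (auto simp: eisenstein_vec_def coeff_0_power cong_dvd_iff)
  then show False using t by (simp add: eisenstein_vec_def g_def)
qed

lemma card_loc_affine_eisenstein_residues:
  assumes p: "prime (p::nat)" and n: "n \<ge> 1"
  shows "card {r \<in> residue_vecs (n + 1) (p\<^sup>2). loc_affine_eisenstein n (int p) r}
       = (p + 1) * (p - 1)\<^sup>2 * p ^ n"
proof -
  let ?R = "residue_vecs (n + 1) (p\<^sup>2)"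
  have p0: "p > 0" using p prime_gt_0_nat by simp
  define X where "X t = {r \<in> ?R. eisenstein_vec (int p) n (coeff (hom_subst n r [:t, 1:] [:1:]))}" for t
  define Y where "Y = {r \<in> ?R. eisenstein_vec (int p) n (coeff (hom_subst n r [:1:] [:0, 1:]))}"
  have X: "card (X t) = (p - 1)\<^sup>2 * p ^ n" for t
    using card_eisenstein_transform_residues[of 1 "-t" 1 t 1 0 0 1 "p\<^sup>2" "int p" n] p0
      card_eisenstein_residues[OF p n] by (simp add: X_def)
  have Y: "card Y = (p - 1)\<^sup>2 * p ^ n"
    using card_eisenstein_transform_residues[of 0 1 0 1 0 1 1 0 "p\<^sup>2" "int p" n] p0
      card_eisenstein_residues[OF p n] by (simp add: Y_def)
  have fin: "finite (X t)" "finite Y" for t by (auto simp: X_def Y_def finite_residue_vecs)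
  have "{r \<in> ?R. loc_affine_eisenstein n (int p) r} = Y \<union> (\<Union>t\<in>{0..<int p}. X t)"
    by (auto simp: loc_affine_eisenstein_def X_def Y_def)
  moreover have "Y \<inter> (\<Union>t\<in>{0..<int p}. X t) = {}"
    using eisenstein_shift_not_reversal[of "int p" n] p n by (auto simp: X_def Y_def)
  moreover have "card (\<Union>t\<in>{0..<int p}. X t) = (\<Sum>t\<in>{0..<int p}. card (X t))"
    using eisenstein_shift_unique[of "int p" _ _ n] p n fin
    by (intro card_UN_disjoint) (auto simp: X_def)
  ultimately show ?thesis using fin by (simp add: card_Un_disjoint X Y algebra_simps)
qed

section \<open>Densities of periodic sets\<close>

definition int_interval :: "real \<Rightarrow> int set" where
  "int_interval B = {k. real_of_int k \<in> {-B..<B}}"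

lemma int_interval_residue_class_eq:
  assumes "m > 0"
  shows "{k \<in> int_interval B. [k = r] (mod int m)}
    = (\<lambda>j. int m * j + r) ` {\<lceil>(-B - r) / m\<rceil>..<\<lceil>(B - r) / m\<rceil>}"
proof -
  have *: "int m * j + r \<in> int_interval B \<longleftrightarrow> j \<in> {\<lceil>(-B - r) / m\<rceil>..<\<lceil>(B - r) / m\<rceil>}" for j
    using assms by (auto simp: int_interval_def ceiling_le_iff less_ceiling_iff field_simps)
  show ?thesis
  proof (intro equalityI subsetI)
    fix k assume "k \<in> {k \<in> int_interval B. [k = r] (mod int m)}"
    then obtain j where "k = int m * j + r" "k \<in> int_interval B"
      by (metis (no_types, lifting) cong_iff_lin cong_sym mem_Collect_eq add.commute)
    then show "k \<in> (\<lambda>j. int m * j + r) ` {\<lceil>(-B - r) / m\<rceil>..<\<lceil>(B - r) / m\<rceil>}"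
      using * by blast
  next
    fix k assume "k \<in> (\<lambda>j. int m * j + r) ` {\<lceil>(-B - r) / m\<rceil>..<\<lceil>(B - r) / m\<rceil>}"
    then show "k \<in> {k \<in> int_interval B. [k = r] (mod int m)}"
      using * by (auto simp: cong_def simp del: atLeastLessThan_iff)
  qed
qed

lemma card_int_interval_residue_class:
  assumes "m > 0" "B \<ge> 0"
  shows "\<bar>real (card {k \<in> int_interval B. [k = r] (mod int m)}) - 2 * B / m\<bar> \<le> 1"
proof -
  define x y where "x = (-B - real_of_int r) / m" and "y = (B - real_of_int r) / m"
  have xy: "y - x = 2 * B / m" "x \<le> y" using assms by (auto simp: x_def y_def field_simps)
  have "inj_on (\<lambda>j. int m * j + r) {\<lceil>x\<rceil>..<\<lceil>y\<rceil>}" using assms by (auto simp: inj_on_def)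
  then have "card {k \<in> int_interval B. [k = r] (mod int m)} = nat (\<lceil>y\<rceil> - \<lceil>x\<rceil>)"
    unfolding int_interval_residue_class_eq[OF assms(1)] by (simp add: card_image x_def y_def)
  moreover have "\<lceil>x\<rceil> \<le> \<lceil>y\<rceil>" using xy by (intro ceiling_mono)
  ultimately have "real (card {k \<in> int_interval B. [k = r] (mod int m)}) = real_of_int \<lceil>y\<rceil> - real_of_int \<lceil>x\<rceil>"
    by simp
  moreover have "real_of_int \<lceil>y\<rceil> < y + 1" "real_of_int \<lceil>x\<rceil> < x + 1"
      "y \<le> real_of_int \<lceil>y\<rceil>" "x \<le> real_of_int \<lceil>x\<rceil>" by linarith+
  ultimately show ?thesis using xy by linarith
qed

lemma finite_int_interval: "finite (int_interval B)"
proof -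
  have "finite {k \<in> int_interval B. [k = 0] (mod int 1)}"
    by (subst int_interval_residue_class_eq) auto
  then show ?thesis by simp
qed

lemma card_int_interval_le: "B \<ge> 0 \<Longrightarrow> real (card (int_interval B)) \<le> 2 * B + 1"
  using card_int_interval_residue_class[of 1 B 0] by (simp add: abs_le_iff)

lemma int_box_eq: "int_box d B = {..<d} \<rightarrow>\<^sub>E int_interval B"
  by (simp add: int_box_def int_interval_def)

lemma finite_int_box: "finite (int_box d B)"
  by (simp add: int_box_eq finite_PiE finite_int_interval)

lemma tendsto_residue_class_density:
  assumes "m > 0"
  shows "((\<lambda>B. real (card {k \<in> int_interval B. [k = r] (mod int m)}) / (2 * B)) \<longlongrightarrow> 1 / real m) at_top"
proof -
  have "((\<lambda>B. real (card {k \<in> int_interval B. [k = r] (mod int m)}) / (2 * B) - 1 / real m) \<longlongrightarrow> 0) at_top"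
  proof (rule tendsto_rabs_zero_cancel, rule tendsto_sandwich[of "\<lambda>_. 0" _ _ "\<lambda>B. 1 / (2 * B)"])
    show "\<forall>\<^sub>F B in at_top. \<bar>real (card {k \<in> int_interval B. [k = r] (mod int m)}) / (2 * B) - 1 / real m\<bar> \<le> 1 / (2 * B)"
      using eventually_gt_at_top[of 0]
    proof eventually_elim
      case (elim B)
      have "real (card {k \<in> int_interval B. [k = r] (mod int m)}) / (2 * B) - 1 / real m
        = (real (card {k \<in> int_interval B. [k = r] (mod int m)}) - 2 * B / m) / (2 * B)"
        using elim by (simp add: diff_divide_distrib)
      then show ?case using card_int_interval_residue_class[of m B r] assms elim
        by (simp add: divide_right_mono)
    qed
    show "((\<lambda>B::real. 1 / (2 * B)) \<longlongrightarrow> 0) at_top" by real_asymp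
  qed simp_all
  then show ?thesis by (rule LIM_zero_cancel)
qed

text \<open>
  The set is a finite disjoint union of boxes of residue classes, and the count in each box is the product
  of the counts along the coordinates, each of which is \<open>2 * B / N\<close> up to an error of at most \<open>1\<close>.
\<close>

lemma tendsto_periodic_density:
  assumes N: "N > 0"
    and periodic: "\<And>\<alpha> \<beta>. (\<And>i. i < d \<Longrightarrow> [\<alpha> i = \<beta> i] (mod int N)) \<Longrightarrow> D \<alpha> = D \<beta>"
  shows "((\<lambda>B. real (card {\<alpha> \<in> int_box d B. D \<alpha>}) / (2 * B) ^ d) \<longlongrightarrow>
           real (card {r \<in> residue_vecs d N. D r}) / real N ^ d) at_top"
proof -
  define R where "R = {r \<in> residue_vecs d N. D r}"
  have finR: "finite R" by (simp add: R_def finite_residue_vecs)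
  define cls where "cls B r = (\<Pi>\<^sub>E i\<in>{..<d}. {k \<in> int_interval B. [k = r i] (mod int N)})" for B r
  have decomp: "{\<alpha> \<in> int_box d B. D \<alpha>} = (\<Union>r\<in>R. cls B r)" for B
  proof (intro equalityI subsetI)
    fix \<alpha> assume \<alpha>: "\<alpha> \<in> {\<alpha> \<in> int_box d B. D \<alpha>}"
    define r where "r = (\<lambda>i\<in>{..<d}. \<alpha> i mod int N)"
    have "D r = D \<alpha>" by (rule periodic) (simp add: r_def)
    then have "r \<in> R" using \<alpha> N by (auto simp: R_def residue_vecs_def r_def)
    moreover have "\<alpha> \<in> cls B r" using \<alpha> by (auto simp: cls_def int_box_eq PiE_iff r_def cong_def)
    ultimately show "\<alpha> \<in> (\<Union>r\<in>R. cls B r)" by blast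
  next
    fix \<alpha> assume "\<alpha> \<in> (\<Union>r\<in>R. cls B r)"
    then obtain r where r: "r \<in> R" "\<alpha> \<in> cls B r" by blast
    have "D \<alpha> = D r" using r by (intro periodic) (auto simp: cls_def PiE_iff)
    then show "\<alpha> \<in> {\<alpha> \<in> int_box d B. D \<alpha>}"
      using r by (auto simp: cls_def int_box_eq PiE_iff R_def)
  qed
  have disj: "cls B r \<inter> cls B s = {}" if "r \<in> R" "s \<in> R" "r \<noteq> s" for B r s
  proof (rule ccontr)
    assume "cls B r \<inter> cls B s \<noteq> {}"
    then obtain \<alpha> where \<alpha>: "\<alpha> \<in> cls B r" "\<alpha> \<in> cls B s" by blast
    have "r = s"
    proof (rule PiE_ext)
      show "r \<in> {..<d} \<rightarrow>\<^sub>E {0..<int N}" "s \<in> {..<d} \<rightarrow>\<^sub>E {0..<int N}"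
        using that by (auto simp: R_def residue_vecs_def)
      fix i assume i: "i \<in> {..<d}"
      then have "[\<alpha> i = r i] (mod int N)" "[\<alpha> i = s i] (mod int N)"
        using \<alpha> by (auto simp: cls_def PiE_iff)
      then have "[r i = s i] (mod int N)" using cong_sym cong_trans by blast
      then show "r i = s i" using that i
        by (intro cong_less_imp_eq_int) (auto simp: R_def residue_vecs_def PiE_iff)
    qed
    then show False using that by simp
  qed
  have "card {\<alpha> \<in> int_box d B. D \<alpha>} = (\<Sum>r\<in>R. \<Prod>i<d. card {k \<in> int_interval B. [k = r i] (mod int N)})" for B
  proof -
    have "card (\<Union>r\<in>R. cls B r) = (\<Sum>r\<in>R. card (cls B r))"
      using finR disj by (intro card_UN_disjoint) (auto simp: cls_def intro!: finite_PiE simp: finite_int_interval)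
    then show ?thesis by (simp add: decomp cls_def card_PiE)
  qed
  then have "(\<lambda>B. real (card {\<alpha> \<in> int_box d B. D \<alpha>}) / (2 * B) ^ d) =
     (\<lambda>B. \<Sum>r\<in>R. \<Prod>i<d. real (card {k \<in> int_interval B. [k = r i] (mod int N)}) / (2 * B))"
    by (simp add: sum_divide_distrib prod_dividef)
  moreover have "((\<lambda>B. \<Sum>r\<in>R. \<Prod>i<d. real (card {k \<in> int_interval B. [k = r i] (mod int N)}) / (2 * B))
      \<longlongrightarrow> (\<Sum>r\<in>R. \<Prod>i<d. 1 / real N)) at_top"
    by (intro tendsto_sum tendsto_prod tendsto_residue_class_density N)
  moreover have "(\<Sum>r\<in>R. \<Prod>i<d. 1 / real N) = real (card R) / real N ^ d"
    by (simp add: power_divide)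
  ultimately show ?thesis by (simp only: R_def)
qed

section \<open>Independence of finitely many primes\<close>

lemma card_residue_vecs_coprime:
  assumes MN: "M > 0" "N > 0" and cop: "coprime M N"
    and per1: "\<And>\<alpha> \<beta>. (\<And>i. i < d \<Longrightarrow> [\<alpha> i = \<beta> i] (mod int M)) \<Longrightarrow> D \<alpha> = D \<beta>"
    and per2: "\<And>\<alpha> \<beta>. (\<And>i. i < d \<Longrightarrow> [\<alpha> i = \<beta> i] (mod int N)) \<Longrightarrow> E \<alpha> = E \<beta>"
  shows "card {r \<in> residue_vecs d (M * N). D r \<and> E r}
    = card {r \<in> residue_vecs d M. D r} * card {r \<in> residue_vecs d N. E r}"
proof -
  define red where "red K r = (\<lambda>i\<in>{..<d}. r i mod int K)" for K and r :: "nat \<Rightarrow> int"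
  have red_in: "K > 0 \<Longrightarrow> red K r \<in> residue_vecs d K" for K r
    by (auto simp: red_def residue_vecs_def)
  have D_red: "D (red M r) = D r" and E_red: "E (red N r) = E r" for r
    by (rule per1, simp add: red_def) (rule per2, simp add: red_def)
  have "bij_betw (\<lambda>r. (red M r, red N r)) {r \<in> residue_vecs d (M * N). D r \<and> E r}
     ({r \<in> residue_vecs d M. D r} \<times> {r \<in> residue_vecs d N. E r})"
    unfolding bij_betw_def
  proof
    show "inj_on (\<lambda>r. (red M r, red N r)) {r \<in> residue_vecs d (M * N). D r \<and> E r}"
    proof (rule inj_onI)
      fix r s assume r: "r \<in> {r \<in> residue_vecs d (M * N). D r \<and> E r}"
        and s: "s \<in> {r \<in> residue_vecs d (M * N). D r \<and> E r}"
        and eq: "(red M r, red N r) = (red M s, red N s)"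
      show "r = s"
      proof (rule PiE_ext)
        show "r \<in> {..<d} \<rightarrow>\<^sub>E {0..<int (M * N)}" "s \<in> {..<d} \<rightarrow>\<^sub>E {0..<int (M * N)}"
          using r s by (auto simp: residue_vecs_def)
        fix i assume i: "i \<in> {..<d}"
        have "red M r i = red M s i" "red N r i = red N s i" using eq by auto
        then have "[r i = s i] (mod int M)" "[r i = s i] (mod int N)"
          using i by (auto simp: red_def cong_def)
        then have "[r i = s i] (mod int (M * N))"
          using cop by (simp add: coprime_cong_mult)
        then show "r i = s i"
          using r s i PiE_mem[of r "{..<d}" "\<lambda>_. {0..<int (M * N)}" i] PiE_mem[of s "{..<d}" "\<lambda>_. {0..<int (M * N)}" i]
          by (intro cong_less_imp_eq_int) (simp_all add: residue_vecs_def)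
      qed
    qed
    show "(\<lambda>r. (red M r, red N r)) ` {r \<in> residue_vecs d (M * N). D r \<and> E r}
      = {r \<in> residue_vecs d M. D r} \<times> {r \<in> residue_vecs d N. E r}"
    proof (intro equalityI subsetI)
      fix x assume "x \<in> (\<lambda>r. (red M r, red N r)) ` {r \<in> residue_vecs d (M * N). D r \<and> E r}"
      then show "x \<in> {r \<in> residue_vecs d M. D r} \<times> {r \<in> residue_vecs d N. E r}"
        using red_in MN D_red E_red by auto
    next
      fix x assume "x \<in> {r \<in> residue_vecs d M. D r} \<times> {r \<in> residue_vecs d N. E r}"
      then obtain s t where x: "x = (s, t)" and s: "s \<in> residue_vecs d M" "D s"
        and t: "t \<in> residue_vecs d N" "E t" by auto
      have "\<exists>k. [k = s i] (mod int M) \<and> [k = t i] (mod int N)" for i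
        using binary_chinese_remainder_int[of "int M" "int N"] cop by simp
      then obtain k where k: "\<And>i. [k i = s i] (mod int M)" "\<And>i. [k i = t i] (mod int N)" by metis
      define r where "r = red (M * N) k"
      have cM: "[r i = k i] (mod int M)" and cN: "[r i = k i] (mod int N)" if "i < d" for i
        using that by (auto simp: r_def red_def cong_def mod_mod_cancel)
      have rs: "[r i = s i] (mod int M)" and rt: "[r i = t i] (mod int N)" if "i < d" for i
        using cM[OF that] cN[OF that] k cong_trans by blast+
      have "red M r = s"
      proof (rule PiE_ext)
        show "red M r \<in> {..<d} \<rightarrow>\<^sub>E {0..<int M}" "s \<in> {..<d} \<rightarrow>\<^sub>E {0..<int M}"
          using red_in[of M r] s MN by (auto simp: residue_vecs_def)
        fix i assume i: "i \<in> {..<d}"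
        then have "s i \<in> {0..<int M}" using s(1) by (auto simp: residue_vecs_def PiE_iff)
        then show "red M r i = s i" using rs[of i] i by (simp add: red_def cong_def)
      qed
      moreover have "red N r = t"
      proof (rule PiE_ext)
        show "red N r \<in> {..<d} \<rightarrow>\<^sub>E {0..<int N}" "t \<in> {..<d} \<rightarrow>\<^sub>E {0..<int N}"
          using red_in[of N r] t MN by (auto simp: residue_vecs_def)
        fix i assume i: "i \<in> {..<d}"
        then have "t i \<in> {0..<int N}" using t(1) by (auto simp: residue_vecs_def PiE_iff)
        then show "red N r i = t i" using rt[of i] i by (simp add: red_def cong_def)
      qed
      moreover have "r \<in> residue_vecs d (M * N)" unfolding r_def using MN by (intro red_in) simp
      moreover have "D r" "E r" using per1[of r s, OF rs] per2[of r t, OF rt] s t by simp_all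
      ultimately show "x \<in> (\<lambda>r. (red M r, red N r)) ` {r \<in> residue_vecs d (M * N). D r \<and> E r}"
        using x by (intro image_eqI[of _ _ r]) auto
    qed
  qed
  then show ?thesis by (simp add: bij_betw_same_card card_cartesian_product)
qed

lemma card_residues_avoiding_primes:
  assumes n: "n \<ge> 1" and P: "finite P" "\<And>p. p \<in> P \<Longrightarrow> prime (p::nat)"
  shows "real (card {r \<in> residue_vecs (n + 1) (\<Prod>p\<in>P. p\<^sup>2). \<forall>p\<in>P. \<not> loc_affine_eisenstein n (int p) r})
     / real (\<Prod>p\<in>P. p\<^sup>2) ^ (n + 1)
   = (\<Prod>p\<in>P. 1 - (real p + 1) * (real p - 1)\<^sup>2 / real p ^ (n + 2))"
  using P
proof (induction P rule: finite_induct)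
  case empty
  then show ?case by (simp add: card_residue_vecs)
next
  case (insert q P)
  define N where "N = (\<Prod>p\<in>P. p\<^sup>2)"
  have q: "prime q" "q > 0" using insert.prems prime_gt_0_nat by auto
  have N0: "N > 0" using insert by (auto simp: N_def prime_gt_0_nat)
  have cop: "coprime (q\<^sup>2) N"
    unfolding N_def 
  proof (rule prod_coprime_right)
    fix p assume "p \<in> P"
    then have "coprime q p" using insert by (intro primes_coprime) auto
    then show "coprime (q\<^sup>2) (p\<^sup>2)" by simp
  qed
  have split: "card {r \<in> residue_vecs (n + 1) (q\<^sup>2 * N). \<not> loc_affine_eisenstein n (int q) r \<and>
       (\<forall>p\<in>P. \<not> loc_affine_eisenstein n (int p) r)}
    = card {r \<in> residue_vecs (n + 1) (q\<^sup>2). \<not> loc_affine_eisenstein n (int q) r}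
      * card {r \<in> residue_vecs (n + 1) N. \<forall>p\<in>P. \<not> loc_affine_eisenstein n (int p) r}"
  proof (rule card_residue_vecs_coprime)
    fix \<alpha> \<beta> :: "nat \<Rightarrow> int"
    assume "\<And>i. i < n + 1 \<Longrightarrow> [\<alpha> i = \<beta> i] (mod int (q\<^sup>2))"
    then show "(\<not> loc_affine_eisenstein n (int q) \<alpha>) = (\<not> loc_affine_eisenstein n (int q) \<beta>)"
      using loc_affine_eisenstein_cong[of n \<alpha> \<beta> "int q"] by simp
  next
    fix \<alpha> \<beta> :: "nat \<Rightarrow> int"
    assume cong: "\<And>i. i < n + 1 \<Longrightarrow> [\<alpha> i = \<beta> i] (mod int N)"
    have "loc_affine_eisenstein n (int p) \<alpha> = loc_affine_eisenstein n (int p) \<beta>" if "p \<in> P" for p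
    proof (rule loc_affine_eisenstein_cong)
      fix i assume "i \<le> n"
      moreover have "p\<^sup>2 dvd N" unfolding N_def using that insert.hyps by (intro dvd_prodI) auto
      then have "(int p)\<^sup>2 dvd int N" by (metis of_nat_dvd_iff of_nat_power)
      ultimately show "[\<alpha> i = \<beta> i] (mod (int p)\<^sup>2)"
        using cong[of i] cong_dvd_modulus by simp
    qed
    then show "(\<forall>p\<in>P. \<not> loc_affine_eisenstein n (int p) \<alpha>) = (\<forall>p\<in>P. \<not> loc_affine_eisenstein n (int p) \<beta>)"
      by auto
  qed (use q N0 cop in auto)
  have "{r \<in> residue_vecs (n + 1) (q\<^sup>2). \<not> loc_affine_eisenstein n (int q) r}
     = residue_vecs (n + 1) (q\<^sup>2) - {r \<in> residue_vecs (n + 1) (q\<^sup>2). loc_affine_eisenstein n (int q) r}"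
    by auto
  then have "card {r \<in> residue_vecs (n + 1) (q\<^sup>2). \<not> loc_affine_eisenstein n (int q) r}
     = (q\<^sup>2) ^ (n + 1) - (q + 1) * (q - 1)\<^sup>2 * q ^ n"
    using card_loc_affine_eisenstein_residues[OF q(1) n]
    by (simp add: card_Diff_subset finite_residue_vecs card_residue_vecs)
  moreover have "(q + 1) * (q - 1)\<^sup>2 * q ^ n \<le> (q\<^sup>2) ^ (n + 1)"
    using card_loc_affine_eisenstein_residues[OF q(1) n]
     card_mono[of "residue_vecs (n + 1) (q\<^sup>2)" "{r \<in> residue_vecs (n + 1) (q\<^sup>2). loc_affine_eisenstein n (int q) r}"]
    by (simp add: finite_residue_vecs card_residue_vecs del: power_Suc)
  ultimately have "real (card {r \<in> residue_vecs (n + 1) (q\<^sup>2). \<not> loc_affine_eisenstein n (int q) r})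
     = (real q ^ 2) ^ (n + 1) - (real q + 1) * (real q - 1)\<^sup>2 * real q ^ n"
    using q by (simp add: of_nat_diff distrib_right del: power_Suc)
  then have at_q: "real (card {r \<in> residue_vecs (n + 1) (q\<^sup>2). \<not> loc_affine_eisenstein n (int q) r}) / real (q\<^sup>2) ^ (n + 1)
     = 1 - (real q + 1) * (real q - 1)\<^sup>2 / real q ^ (n + 2)"
  proof -
    have "real q ^ (n + 2) * real q ^ n = (real q ^ 2) ^ (n + 1)"
      by (simp add: power_add power_mult_distrib power2_eq_square)
    then have "(real q + 1) * (real q - 1)\<^sup>2 / real q ^ (n + 2)
      = (real q + 1) * (real q - 1)\<^sup>2 * real q ^ n / (real q ^ 2) ^ (n + 1)"
      using q by (simp add: divide_simps mult.commute del: power_Suc)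
    moreover have "(real q ^ 2) ^ (n + 1) \<noteq> 0" using q by simp
    ultimately show ?thesis using \<open>real (card _) = _\<close> by (simp add: diff_divide_distrib del: power_Suc)
  qed
  have at_P: "real (card {r \<in> residue_vecs (n + 1) N. \<forall>p\<in>P. \<not> loc_affine_eisenstein n (int p) r}) / real N ^ (n + 1)
     = (\<Prod>p\<in>P. 1 - (real p + 1) * (real p - 1)\<^sup>2 / real p ^ (n + 2))"
    using insert by (simp add: N_def)
  have prod_eq: "(\<Prod>p\<in>insert q P. p\<^sup>2) = q\<^sup>2 * N" using insert.hyps by (simp add: N_def)
  have "{r \<in> residue_vecs (n + 1) (q\<^sup>2 * N). \<forall>p\<in>insert q P. \<not> loc_affine_eisenstein n (int p) r}
      = {r \<in> residue_vecs (n + 1) (q\<^sup>2 * N). \<not> loc_affine_eisenstein n (int q) r \<and>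
       (\<forall>p\<in>P. \<not> loc_affine_eisenstein n (int p) r)}"
    by auto
  then show ?case
    unfolding prod_eq prod.insert[OF insert.hyps] at_q[symmetric] at_P[symmetric]
    by (simp only: split of_nat_mult power_mult_distrib times_divide_times_eq)
qed

lemma tendsto_avoiding_primes_density:
  assumes n: "n \<ge> 1" and P: "finite P" "\<And>p. p \<in> P \<Longrightarrow> prime (p::nat)"
  shows "((\<lambda>B. real (card {\<alpha> \<in> int_box (n + 1) B. \<forall>p\<in>P. \<not> loc_affine_eisenstein n (int p) \<alpha>}) / (2 * B) ^ (n + 1))
    \<longlongrightarrow> (\<Prod>p\<in>P. 1 - (real p + 1) * (real p - 1)\<^sup>2 / real p ^ (n + 2))) at_top"
proof (subst card_residues_avoiding_primes[OF n P, symmetric], assumption, rule tendsto_periodic_density)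
  show "0 < (\<Prod>p\<in>P. p\<^sup>2)" using P by (auto simp: prime_gt_0_nat)
  fix \<alpha> \<beta> :: "nat \<Rightarrow> int"
  assume cong: "\<And>i. i < n + 1 \<Longrightarrow> [\<alpha> i = \<beta> i] (mod int (\<Prod>p\<in>P. p\<^sup>2))"
  have "loc_affine_eisenstein n (int p) \<alpha> = loc_affine_eisenstein n (int p) \<beta>" if "p \<in> P" for p
  proof (rule loc_affine_eisenstein_cong)
    fix i assume "i \<le> n"
    moreover have "p\<^sup>2 dvd (\<Prod>p\<in>P. p\<^sup>2)" using that P by (intro dvd_prodI) auto
    then have "(int p)\<^sup>2 dvd int (\<Prod>p\<in>P. p\<^sup>2)" by (metis of_nat_dvd_iff of_nat_power)
    ultimately show "[\<alpha> i = \<beta> i] (mod (int p)\<^sup>2)"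
      using cong[of i] cong_dvd_modulus by (metis Suc_eq_plus1 le_imp_less_Suc)
  qed
  then show "(\<forall>p\<in>P. \<not> loc_affine_eisenstein n (int p) \<alpha>) = (\<forall>p\<in>P. \<not> loc_affine_eisenstein n (int p) \<beta>)"
    by auto
qed

section \<open>Large primes\<close>

lemma card_int_interval_bounds:
  assumes "B \<ge> 1"
  shows "real (card (int_interval B)) \<le> 3 * B"
  using card_int_interval_le[of B] assms by linarith

lemma card_linear_congruence_le:
  assumes p: "prime (p::nat)" and c: "\<not> int p dvd c" and B: "B \<ge> 0"
  shows "real (card {k \<in> int_interval B. int p dvd c * k + e}) \<le> 2 * B / p + 1"
proof (cases "{k \<in> int_interval B. int p dvd c * k + e} = {}")
  case True
  then show ?thesis unfolding True using B by simp
next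
  case False
  then obtain r where r: "int p dvd c * r + e" by blast
  have "{k \<in> int_interval B. int p dvd c * k + e} \<subseteq> {k \<in> int_interval B. [k = r] (mod int p)}"
  proof clarify
    fix k assume "int p dvd c * k + e"
    then have "int p dvd (c * k + e) - (c * r + e)" using r by (rule dvd_diff)
    then have "int p dvd c * (k - r)" by (simp add: algebra_simps)
    then show "[k = r] (mod int p)"
      using p c by (simp add: prime_dvd_mult_iff cong_iff_dvd_diff)
  qed
  then have "card {k \<in> int_interval B. int p dvd c * k + e} \<le> card {k \<in> int_interval B. [k = r] (mod int p)}"
    by (intro card_mono) (simp_all add: finite_int_interval)
  then show ?thesis
    using card_int_interval_residue_class[of p B r] p B by (simp add: prime_gt_0_nat abs_le_iff)
qed

lemma card_Sigma_le:
  fixes K :: real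
  assumes "finite A" "\<And>a. a \<in> A \<Longrightarrow> finite (F a)" "\<And>a. a \<in> A \<Longrightarrow> real (card (F a)) \<le> K"
    and "real (card A) \<le> L" "K \<ge> 0"
  shows "real (card (Sigma A F)) \<le> L * K"
proof -
  have "real (card (Sigma A F)) = (\<Sum>a\<in>A. real (card (F a)))"
    using assms by (simp add: card_SigmaI)
  also have "\<dots> \<le> real (card A) * K"
    using assms sum_bounded_above[of A "\<lambda>a. real (card (F a))" K] by simp
  also have "\<dots> \<le> L * K" using assms by (intro mult_right_mono) auto
  finally show ?thesis .
qed

text \<open>
  Three distinct primes above \<open>B\<close> have a product above \<open>B ^ 3\<close>.
\<close>

lemma card_large_prime_divisors_le:
  assumes Q: "Q \<noteq> 0" "\<bar>real_of_int Q\<bar> \<le> B ^ 3" and B: "B \<ge> 1"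
  shows "finite {p::nat. prime p \<and> real p > B \<and> int p dvd Q}"
    and "card {p::nat. prime p \<and> real p > B \<and> int p dvd Q} \<le> 2"
proof -
  define S where "S = {p::nat. prime p \<and> real p > B \<and> int p dvd Q}"
  have "S \<subseteq> {..nat \<bar>Q\<bar>}"
  proof
    fix p assume "p \<in> S"
    then have "\<bar>int p\<bar> \<le> \<bar>Q\<bar>" using Q by (intro dvd_imp_le_int) (auto simp: S_def)
    then show "p \<in> {..nat \<bar>Q\<bar>}" by simp
  qed
  then show fin: "finite {p::nat. prime p \<and> real p > B \<and> int p dvd Q}"
    unfolding S_def[symmetric] by (rule finite_subset) simp
  show "card {p::nat. prime p \<and> real p > B \<and> int p dvd Q} \<le> 2"
  proof (rule ccontr)
    assume "\<not> card {p::nat. prime p \<and> real p > B \<and> int p dvd Q} \<le> 2"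
    then have "3 \<le> card S" by (simp add: S_def)
    then obtain T where T: "T \<subseteq> S" "card T = 3" by (metis obtain_subset_with_card_n)
    then obtain x y z where xyz: "T = {x, y, z}" "x \<noteq> y" "y \<noteq> z" "x \<noteq> z" by (auto simp: card_3_iff)
    then have pr: "prime x" "prime y" "prime z" "real x > B" "real y > B" "real z > B"
        "int x dvd Q" "int y dvd Q" "int z dvd Q" using T by (auto simp: S_def)
    have xy: "int x * int y dvd Q" 
      using pr xyz by (intro divides_mult coprime_int_iff[THEN iffD2] primes_coprime)
    have "coprime (x * y) z" using pr xyz by (simp add: primes_coprime)
    then have "coprime (int x * int y) (int z)" by (metis coprime_int_iff of_nat_mult)
    with xy pr(9) have "int x * int y * int z dvd Q" by (rule divides_mult)
    then have "int x * int y * int z \<le> \<bar>Q\<bar>" using Q dvd_imp_le_int[of Q "int x * int y * int z"] by simp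
    then have "real_of_int (int x * int y * int z) \<le> real_of_int \<bar>Q\<bar>"
      by (rule of_int_le_iff[THEN iffD2])
    then have "real x * real y * real z \<le> \<bar>real_of_int Q\<bar>" by simp
    moreover have "B * B * B < real x * real y * real z"
      using pr B by (intro mult_strict_mono) (auto intro: mult_pos_pos)
    ultimately show False using Q by (simp add: power3_eq_cube)
  qed
qed

text \<open>
  The congruences of \<open>loc_affine_eisenstein_quadrics\<close> for the four leading coefficients, listed from the top degree downwards.
\<close>

definition cone_quadrics_dvd :: "nat \<Rightarrow> nat \<Rightarrow> int \<Rightarrow> int \<Rightarrow> int \<Rightarrow> int \<Rightarrow> bool" where
  "cone_quadrics_dvd n p u v w z \<longleftrightarrow>
     int p dvd (int n - 1) * v\<^sup>2 - 2 * int n * u * w \<and>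
     int p dvd (int n - 2) * v * w - 3 * int n * u * z"

lemma not_dvd_small_multiple:
  assumes p: "prime (p::nat)" and "\<not> int p dvd u" "0 < k" "k < p"
  shows "\<not> int p dvd - (int k * u)"
  using assms by (auto simp: prime_dvd_mult_iff dest: zdvd_not_zless nat_dvd_not_less)

text \<open>
  If \<open>p\<close> divides \<open>u\<close>, the first congruence makes it divide \<open>v\<close> as well. Otherwise \<open>u\<close> and \<open>v\<close>
  determine \<open>w\<close> and then \<open>z\<close> modulo \<open>p\<close>. Either way two of the four coordinates are confined to
  a residue class, which has at most \<open>3 * B / p\<close> elements in the interval because \<open>p \<le> B\<close>.
\<close>

lemma card_cone_quadrics_small_prime:
  assumes n: "n \<ge> 3" and p: "prime (p::nat)" "p > 3 * n" "real p \<le> B"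
  shows "real (card {(u, v, w, z). u \<in> int_interval B \<and> v \<in> int_interval B \<and> w \<in> int_interval B \<and>
            z \<in> int_interval B \<and> cone_quadrics_dvd n p u v w z}) \<le> 162 * B ^ 4 / (real p)\<^sup>2"
proof -
  let ?I = "int_interval B"
  have B: "B \<ge> 1" using p prime_ge_1_nat[OF p(1)] by linarith
  have p0: "real p > 0" using p by (simp add: prime_gt_0_nat)
  note I = card_int_interval_bounds[OF B]
  have cls: "real (card {k \<in> ?I. int p dvd c * k + e}) \<le> 3 * B / p" if "\<not> int p dvd c" for c e
  proof -
    have "2 * B / p + 1 \<le> 3 * B / p" using p p0 by (simp add: field_simps)
    then show ?thesis using card_linear_congruence_le[OF p(1) that, of B e] B by linarith
  qed
  define U where "U = {k \<in> ?I. int p dvd 1 * k + 0}"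
  have U: "real (card U) \<le> 3 * B / p"
    unfolding U_def using not_prime_unit[of p] p(1) by (intro cls) auto
  define X where "X = U \<times> U \<times> ?I \<times> ?I"
  define V where "V u v = {w \<in> ?I. int p dvd (- (int (2 * n) * u)) * w + (int n - 1) * v\<^sup>2}" for u v
  define W where "W u v w = {z \<in> ?I. int p dvd (- (int (3 * n) * u)) * z + (int n - 2) * v * w}" for u v w
  define A where "A = {u \<in> ?I. \<not> int p dvd u}"
  define Y where "Y = (SIGMA u:A. SIGMA v:?I. SIGMA w:V u v. W u v w)"
  note fin = finite_int_interval
  have finU: "finite U" "finite A" "finite (V u v)" "finite (W u v w)" for u v w
    by (auto simp: U_def A_def V_def W_def fin)
  have A: "real (card A) \<le> 3 * B"
    using I card_mono[OF fin, of A B] by (auto simp: A_def)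
  have "real (card X) \<le> (3 * B / p) * ((3 * B / p) * ((3 * B) * (3 * B)))"
    unfolding X_def using B p0 by (intro card_Sigma_le finite_cartesian_product finU fin U I) auto
  moreover have "real (card Y) \<le> (3 * B) * ((3 * B) * ((3 * B / p) * (3 * B / p)))"
    unfolding Y_def
  proof (intro card_Sigma_le finite_SigmaI finU fin A I)
    fix u v w assume "u \<in> A"
    then have "\<not> int p dvd - (int (2 * n) * u)" "\<not> int p dvd - (int (3 * n) * u)"
      using not_dvd_small_multiple[of p u] p n by (auto simp: A_def simp del: of_nat_mult)
    then show "real (card (V u v)) \<le> 3 * B / p" "real (card (W u v w)) \<le> 3 * B / p"
      unfolding V_def W_def by - (rule cls, assumption)+
  qed (use B p0 in auto)
  moreover have "{(u, v, w, z). u \<in> ?I \<and> v \<in> ?I \<and> w \<in> ?I \<and> z \<in> ?I \<and> cone_quadrics_dvd n p u v w z} \<subseteq> X \<union> Y"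
  proof clarify
    fix u v w z assume in_I: "u \<in> ?I" "v \<in> ?I" "w \<in> ?I" "z \<in> ?I" and q: "cone_quadrics_dvd n p u v w z"
      and nY: "(u, v, w, z) \<notin> Y"
    have "w \<in> V u v" "z \<in> W u v w"
      using in_I q by (simp_all add: V_def W_def cone_quadrics_dvd_def)
    then have pu: "int p dvd u" using nY in_I by (auto simp: Y_def A_def)
    then have "int p dvd 2 * int n * u * w" by simp
    then have "int p dvd (int n - 1) * v\<^sup>2" using q by (auto simp: cone_quadrics_dvd_def dvd_diff_left_iff)
    moreover have "\<not> int p dvd int n - 1" using zdvd_not_zless[of "int n - 1" "int p"] p n by simp
    ultimately have "int p dvd v\<^sup>2" using p by (auto simp: prime_dvd_mult_iff)
    then have "int p dvd v" using prime_dvd_power[of "int p" v 2] p by simp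
    then show "(u, v, w, z) \<in> X" using pu in_I by (simp add: X_def U_def)
  qed
  then have "card {(u, v, w, z). u \<in> ?I \<and> v \<in> ?I \<and> w \<in> ?I \<and> z \<in> ?I \<and> cone_quadrics_dvd n p u v w z}
      \<le> card (X \<union> Y)"
  proof (rule card_mono[rotated])
    have "finite X" "finite Y"
      unfolding X_def Y_def by (auto intro!: finite_SigmaI simp: fin finU)
    then show "finite (X \<union> Y)" by simp
  qed
  moreover have "card (X \<union> Y) \<le> card X + card Y" by (rule card_Un_le)
  ultimately have "real (card {(u, v, w, z). u \<in> ?I \<and> v \<in> ?I \<and> w \<in> ?I \<and> z \<in> ?I \<and> cone_quadrics_dvd n p u v w z})
     \<le> (3 * B / p) * ((3 * B / p) * ((3 * B) * (3 * B))) + (3 * B) * ((3 * B) * ((3 * B / p) * (3 * B / p)))"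
    by linarith
  also have "\<dots> = 162 * B ^ 4 / (real p)\<^sup>2"
    by (simp add: power2_eq_square power4_eq_xxxx)
  finally show ?thesis .
qed

text \<open>
  A residue class modulo a prime above \<open>B\<close> has at most three elements in the interval, but there
  are too many such primes to add up their contributions. Instead \<open>u, v, w\<close> are chosen first: unless
  \<open>u = 0\<close> or the quadric \<open>Q\<close> vanishes, which each cost one coordinate, \<open>Q\<close> is a nonzero integer
  of absolute value at most \<open>B ^ 3\<close>, so at most two primes above \<open>B\<close> are left, and each allows at most three values of \<open>z\<close>.
\<close>

lemma card_cone_quadrics_large_primes:
  assumes n: "n \<ge> 3" and B: "B \<ge> real (3 * n)"
  shows "real (card {(u, v, w, z). u \<in> int_interval B \<and> v \<in> int_interval B \<and> w \<in> int_interval B \<and>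
            z \<in> int_interval B \<and> (\<exists>p. prime (p::nat) \<and> real p > B \<and> cone_quadrics_dvd n p u v w z)}) \<le> 216 * B ^ 3"
proof -
  let ?I = "int_interval B"
  have B1: "B \<ge> 1" using B n by simp
  note I = card_int_interval_bounds[OF B1] and fin = finite_int_interval
  define Q where "Q u v w = (int n - 1) * v\<^sup>2 - 2 * int n * u * w" for u v w
  define Z where "Z u v w = (\<Union>p\<in>{p::nat. prime p \<and> real p > B \<and> int p dvd Q u v w}.
      {z \<in> ?I. int p dvd (- (int (3 * n) * u)) * z + (int n - 2) * v * w})" for u v w
  have Q_le: "\<bar>real_of_int (Q u v w)\<bar> \<le> B ^ 3" if uvw: "u \<in> ?I" "v \<in> ?I" "w \<in> ?I" for u v w
  proof -
    have le: "\<bar>real_of_int u\<bar> \<le> B" "\<bar>real_of_int v\<bar> \<le> B" "\<bar>real_of_int w\<bar> \<le> B"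
      using uvw by (auto simp: int_interval_def abs_le_iff)
    then have "\<bar>real_of_int v\<bar> * \<bar>real_of_int v\<bar> \<le> B * B" "\<bar>real_of_int u\<bar> * \<bar>real_of_int w\<bar> \<le> B * B"
      using mult_mono[OF le(2) le(2)] mult_mono[OF le(1) le(3)] B1 by simp_all
    then have "(real n - 1) * (\<bar>real_of_int v\<bar> * \<bar>real_of_int v\<bar>) + 2 * real n * (\<bar>real_of_int u\<bar> * \<bar>real_of_int w\<bar>)
        \<le> (real n - 1) * (B * B) + 2 * real n * (B * B)"
      using n by (intro add_mono mult_left_mono) auto
    also have "\<dots> \<le> real (3 * n) * (B * B)" using B1 by (simp add: algebra_simps)
    also have "\<dots> \<le> B * (B * B)" using B B1 by (intro mult_right_mono) auto
    finally have le: "(real n - 1) * (\<bar>real_of_int v\<bar> * \<bar>real_of_int v\<bar>) + 2 * real n * (\<bar>real_of_int u\<bar> * \<bar>real_of_int w\<bar>) \<le> B ^ 3"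
      by (simp add: power3_eq_cube)
    have "\<bar>real_of_int (Q u v w)\<bar> \<le> \<bar>(real n - 1) * (real_of_int v)\<^sup>2\<bar> + \<bar>2 * real n * real_of_int u * real_of_int w\<bar>"
      using abs_triangle_ineq4[of "(real n - 1) * (real_of_int v)\<^sup>2" "2 * real n * real_of_int u * real_of_int w"]
      by (simp add: Q_def)
    also have "\<dots> = (real n - 1) * (\<bar>real_of_int v\<bar> * \<bar>real_of_int v\<bar>) + 2 * real n * (\<bar>real_of_int u\<bar> * \<bar>real_of_int w\<bar>)"
      using n by (simp add: abs_mult power2_eq_square)
    finally show ?thesis using le by simp
  qed
  define X where "X = {0::int} \<times> ?I \<times> ?I \<times> ?I"
  define A where "A = ?I - {0}"
  define Y where "Y = (SIGMA u:A. SIGMA v:?I. SIGMA w:{w \<in> ?I. Q u v w = 0}. ?I)"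
  define T where "T = (SIGMA u:A. SIGMA v:?I. SIGMA w:{w \<in> ?I. Q u v w \<noteq> 0}. Z u v w)"
  have finA: "finite A" and A: "real (card A) \<le> 3 * B"
    using I card_mono[OF fin, of A B] by (auto simp: A_def fin)
  have Z: "finite (Z u v w) \<and> real (card (Z u v w)) \<le> 6"
    if uvw: "u \<in> A" "v \<in> ?I" "w \<in> ?I" "Q u v w \<noteq> 0" for u v w
  proof -
    define P where "P = {p::nat. prime p \<and> real p > B \<and> int p dvd Q u v w}"
    have P: "finite P" "card P \<le> 2"
      unfolding P_def using card_large_prime_divisors_le[OF uvw(4) Q_le B1] uvw by (auto simp: A_def)
    define Zp where "Zp p = {z \<in> ?I. int p dvd (- (int (3 * n) * u)) * z + (int n - 2) * v * w}" for p :: nat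
    have Zp: "real (card (Zp p)) \<le> 3" if p: "p \<in> P" for p
    proof -
      have pr: "prime p" "real p > B" using p by (auto simp: P_def)
      have "\<bar>real_of_int u\<bar> \<le> B" "u \<noteq> 0"
        using uvw by (auto simp: A_def int_interval_def abs_le_iff)
      then have "\<bar>u\<bar> < int p" "u \<noteq> 0" using pr by linarith+
      then have "\<not> int p dvd u" using dvd_imp_le_int[of u "int p"] by force
      moreover have "3 * n < p" using pr B by linarith
      ultimately have "real (card (Zp p)) \<le> 2 * B / p + 1"
        unfolding Zp_def using pr n B1
        by (intro card_linear_congruence_le not_dvd_small_multiple) auto
      also have "\<dots> \<le> 3" using pr B1 by (simp add: field_simps)
      finally show ?thesis .
    qed
    have Zeq: "Z u v w = (\<Union>p\<in>P. Zp p)" by (simp add: Z_def P_def Zp_def)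
    have "real (card (Z u v w)) \<le> (\<Sum>p\<in>P. real (card (Zp p)))"
      unfolding Zeq using card_UN_le[OF P(1), of Zp] by (metis of_nat_le_iff of_nat_sum)
    also have "\<dots> \<le> real (card P) * 3" using sum_bounded_above[OF Zp, of P] by simp
    also have "\<dots> \<le> 6" using P by simp
    finally show ?thesis by (simp add: Zeq Zp_def P fin)
  qed
  have "card {w \<in> ?I. Q u v w = 0} \<le> 1" if "u \<in> A" for u v
    using that n by (auto simp: card_le_Suc0_iff_eq fin Q_def A_def)
  then have w1: "real (card {w \<in> ?I. Q u v w = 0}) \<le> 1" if "u \<in> A" for u v
    using that by (metis of_nat_1 of_nat_le_iff)
  have w2: "real (card {w \<in> ?I. Q u v w \<noteq> 0}) \<le> 3 * B" for u v
  proof -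
    have "card {w \<in> ?I. Q u v w \<noteq> 0} \<le> card ?I" by (intro card_mono fin) auto
    then show ?thesis using I by linarith
  qed
  have "real (card X) \<le> 1 * ((3 * B) * ((3 * B) * (3 * B)))"
    unfolding X_def using B1 by (intro card_Sigma_le finite_cartesian_product fin I) auto
  moreover have "real (card Y) \<le> (3 * B) * ((3 * B) * (1 * (3 * B)))"
    unfolding Y_def using B1 by (intro card_Sigma_le finite_SigmaI fin finA A I w1) (auto simp: fin)
  moreover have "real (card T) \<le> (3 * B) * ((3 * B) * ((3 * B) * 6))"
    unfolding T_def using B1 Z by (intro card_Sigma_le finite_SigmaI fin finA A I w2) (auto simp: fin)
  moreover have "{(u, v, w, z). u \<in> ?I \<and> v \<in> ?I \<and> w \<in> ?I \<and> z \<in> ?I \<and>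
      (\<exists>p. prime (p::nat) \<and> real p > B \<and> cone_quadrics_dvd n p u v w z)} \<subseteq> X \<union> (Y \<union> T)"
  proof
    fix x assume "x \<in> {(u, v, w, z). u \<in> ?I \<and> v \<in> ?I \<and> w \<in> ?I \<and> z \<in> ?I \<and>
      (\<exists>p. prime (p::nat) \<and> real p > B \<and> cone_quadrics_dvd n p u v w z)}"
    then obtain u v w z and p :: nat where x: "x = (u, v, w, z)"
      and in_I: "u \<in> ?I" "v \<in> ?I" "w \<in> ?I" "z \<in> ?I" and p: "prime p" "B < real p"
      and q: "cone_quadrics_dvd n p u v w z" by blast
    have "z \<in> Z u v w"
      unfolding Z_def using q p in_I by (intro UN_I[of p]) (simp_all add: Q_def cone_quadrics_dvd_def)
    then show "x \<in> X \<union> (Y \<union> T)"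
      using in_I by (cases "u = 0"; cases "Q u v w = 0") (simp_all add: x X_def Y_def T_def A_def)
  qed
  then have "card {(u, v, w, z). u \<in> ?I \<and> v \<in> ?I \<and> w \<in> ?I \<and> z \<in> ?I \<and>
      (\<exists>p. prime (p::nat) \<and> real p > B \<and> cone_quadrics_dvd n p u v w z)} \<le> card (X \<union> (Y \<union> T))"
  proof (rule card_mono[rotated])
    have "finite X" "finite Y" "finite T"
      unfolding X_def Y_def T_def using Z by (auto intro!: finite_SigmaI simp: fin finA)
    then show "finite (X \<union> (Y \<union> T))" by simp
  qed
  moreover have "card (X \<union> (Y \<union> T)) \<le> card X + (card Y + card T)"
    using card_Un_le[of X "Y \<union> T"] card_Un_le[of Y T] by linarith
  ultimately show ?thesis by (simp add: power3_eq_cube)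
qed

lemma sum_inverse_squares_le:
  assumes "M \<ge> 1"
  shows "(\<Sum>p\<in>{M<..K}. 1 / (real p)\<^sup>2) \<le> 1 / real M"
proof -
  have "(\<Sum>p\<in>{M<..M + k}. 1 / (real p)\<^sup>2) \<le> 1 / real M - 1 / real (M + k)" for k
  proof (induction k)
    case (Suc k)
    have "{M<..M + Suc k} = insert (M + Suc k) {M<..M + k}" by auto
    then have "(\<Sum>p\<in>{M<..M + Suc k}. 1 / (real p)\<^sup>2)
       = 1 / (real (M + Suc k))\<^sup>2 + (\<Sum>p\<in>{M<..M + k}. 1 / (real p)\<^sup>2)" by simp
    moreover have "1 / (x + 1)\<^sup>2 \<le> 1 / x - 1 / (x + 1)" if "x > 0" for x :: real
    proof -
      have "1 / (x + 1)\<^sup>2 \<le> 1 / (x * (x + 1))"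
        using that by (intro divide_left_mono) (auto simp: power2_eq_square)
      also have "\<dots> = 1 / x - 1 / (x + 1)" using that by (simp add: field_simps)
      finally show ?thesis .
    qed
    from this[of "real (M + k)"] have "1 / (real (M + Suc k))\<^sup>2 \<le> 1 / real (M + k) - 1 / real (M + Suc k)"
      using assms by (simp add: add_ac)
    ultimately show ?case using Suc by linarith
  qed simp
  from this[of "K - M"] have "(\<Sum>p\<in>{M<..M + (K - M)}. 1 / (real p)\<^sup>2) \<le> 1 / real M"
    by (rule order_trans) simp
  moreover have "{M<..K} = {M<..M + (K - M)}" by auto
  ultimately show ?thesis by simp
qed

lemma card_cone_quadrics_tail:
  assumes n: "n \<ge> 3" and M: "M \<ge> 3 * n" and B: "B \<ge> real M"
  shows "real (card {(u, v, w, z). u \<in> int_interval B \<and> v \<in> int_interval B \<and> w \<in> int_interval B \<and>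
            z \<in> int_interval B \<and> (\<exists>p. prime (p::nat) \<and> p > M \<and> cone_quadrics_dvd n p u v w z)}) \<le> 378 * B ^ 4 / M"
proof -
  let ?I = "int_interval B"
  define small where "small p = {(u, v, w, z). u \<in> ?I \<and> v \<in> ?I \<and> w \<in> ?I \<and> z \<in> ?I \<and> cone_quadrics_dvd n p u v w z}" for p
  define large where "large = {(u, v, w, z). u \<in> ?I \<and> v \<in> ?I \<and> w \<in> ?I \<and>
            z \<in> ?I \<and> (\<exists>p. prime (p::nat) \<and> real p > B \<and> cone_quadrics_dvd n p u v w z)}"
  define P where "P = {p\<in>{M<..nat \<lfloor>B\<rfloor>}. prime p}"
  have M0: "real M > 0" "B > 0" using M n B by auto
  have fin: "finite (small p)" "finite large" for p
    unfolding small_def large_def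
    by (rule finite_subset[of _ "?I \<times> ?I \<times> ?I \<times> ?I"]; auto simp: finite_int_interval)+
  have "{(u, v, w, z). u \<in> ?I \<and> v \<in> ?I \<and> w \<in> ?I \<and> z \<in> ?I \<and>
      (\<exists>p. prime (p::nat) \<and> p > M \<and> cone_quadrics_dvd n p u v w z)} \<subseteq> (\<Union>p\<in>P. small p) \<union> large"
  proof clarify
    fix u v w z and p :: nat
    assume in_I: "u \<in> ?I" "v \<in> ?I" "w \<in> ?I" "z \<in> ?I" and p: "prime p" "M < p"
      and q: "cone_quadrics_dvd n p u v w z" and nl: "(u, v, w, z) \<notin> large"
    have "real p \<le> B"
    proof (rule ccontr)
      assume "\<not> real p \<le> B"
      then have "\<exists>p. prime (p::nat) \<and> real p > B \<and> cone_quadrics_dvd n p u v w z"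
        using p q by (intro exI[of _ p]) simp
      then show False using nl in_I by (simp add: large_def)
    qed
    then have "p \<in> P" using p by (simp add: P_def le_nat_floor)
    then show "(u, v, w, z) \<in> (\<Union>p\<in>P. small p)" using in_I q by (auto simp: small_def)
  qed
  then have "card {(u, v, w, z). u \<in> ?I \<and> v \<in> ?I \<and> w \<in> ?I \<and> z \<in> ?I \<and>
      (\<exists>p. prime (p::nat) \<and> p > M \<and> cone_quadrics_dvd n p u v w z)} \<le> card ((\<Union>p\<in>P. small p) \<union> large)"
    by (intro card_mono) (auto simp: P_def fin)
  also have "\<dots> \<le> card (\<Union>p\<in>P. small p) + card large" by (rule card_Un_le)
  also have "\<dots> \<le> (\<Sum>p\<in>P. card (small p)) + card large"
    by (intro add_right_mono card_UN_le) (simp add: P_def)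
  finally have "real (card {(u, v, w, z). u \<in> ?I \<and> v \<in> ?I \<and> w \<in> ?I \<and> z \<in> ?I \<and>
      (\<exists>p. prime (p::nat) \<and> p > M \<and> cone_quadrics_dvd n p u v w z)}) \<le> (\<Sum>p\<in>P. real (card (small p))) + real (card large)"
    by (simp flip: of_nat_sum of_nat_add)
  also have "(\<Sum>p\<in>P. real (card (small p))) \<le> (\<Sum>p\<in>P. 162 * B ^ 4 / (real p)\<^sup>2)"
  proof (rule sum_mono)
    fix p assume "p \<in> P"
    then have p: "prime p" "p > 3 * n" "p \<le> nat \<lfloor>B\<rfloor>" using M by (auto simp: P_def)
    moreover have "real p \<le> B" using p(3) of_nat_floor[of B] M0 by linarith
    ultimately have "prime p" "p > 3 * n" "real p \<le> B" by auto
    then show "real (card (small p)) \<le> 162 * B ^ 4 / (real p)\<^sup>2"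
      unfolding small_def by (rule card_cone_quadrics_small_prime[OF n])
  qed
  also have "\<dots> \<le> (\<Sum>p\<in>{M<..nat \<lfloor>B\<rfloor>}. 162 * B ^ 4 / (real p)\<^sup>2)"
    using M0 by (intro sum_mono2) (auto simp: P_def)
  also have "\<dots> = 162 * B ^ 4 * (\<Sum>p\<in>{M<..nat \<lfloor>B\<rfloor>}. 1 / (real p)\<^sup>2)"
    by (simp add: sum_distrib_left)
  also have "\<dots> \<le> 162 * B ^ 4 * (1 / real M)"
    using M n M0 by (intro mult_left_mono sum_inverse_squares_le) auto
  also have "real (card large) \<le> 216 * B ^ 3"
    unfolding large_def using M B by (intro card_cone_quadrics_large_primes n) linarith
  also have "216 * B ^ 3 \<le> 216 * B ^ 4 / M"
    using M0 B by (simp add: field_simps eval_nat_numeral)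
  finally show ?thesis by (simp add: field_simps)
qed

text \<open>
  The four leading coefficients satisfy the congruences and the other \<open>n - 3\<close> are arbitrary. The constant
  is far from sharp; what matters is that it does not depend on \<open>B\<close>.
\<close>

lemma loc_affine_eisenstein_tail:
  assumes n: "n \<ge> 3" and M: "M \<ge> 3 * n" and B: "B \<ge> real M"
  shows "real (card {\<alpha> \<in> int_box (n + 1) B. \<exists>p. prime (p::nat) \<and> p > M \<and> loc_affine_eisenstein n (int p) \<alpha>})
      / (2 * B) ^ (n + 1) \<le> 378 * 2 ^ n / M"
proof -
  let ?I = "int_interval B"
  define S where "S = {(u, v, w, z). u \<in> ?I \<and> v \<in> ?I \<and> w \<in> ?I \<and> z \<in> ?I \<and>
      (\<exists>p. prime (p::nat) \<and> p > M \<and> cone_quadrics_dvd n p u v w z)}"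
  define T where "T = {\<alpha> \<in> int_box (n + 1) B. \<exists>p. prime (p::nat) \<and> p > M \<and> loc_affine_eisenstein n (int p) \<alpha>}"
  have M0: "real M > 0" "B \<ge> 1" using M n B by auto
  have fin: "finite S"
    unfolding S_def by (rule finite_subset[of _ "?I \<times> ?I \<times> ?I \<times> ?I"]) (auto simp: finite_int_interval)
  define \<phi> where "\<phi> \<alpha> = ((\<alpha> n, \<alpha> (n - 1), \<alpha> (n - 2), \<alpha> (n - 3)), restrict \<alpha> {..<n - 3})" for \<alpha> :: "nat \<Rightarrow> int"
  have "inj_on \<phi> T"
  proof (rule inj_onI)
    fix \<alpha> \<beta> assume \<alpha>: "\<alpha> \<in> T" and \<beta>: "\<beta> \<in> T" and eq: "\<phi> \<alpha> = \<phi> \<beta>"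
    have top: "\<alpha> n = \<beta> n" "\<alpha> (n - 1) = \<beta> (n - 1)" "\<alpha> (n - 2) = \<beta> (n - 2)" "\<alpha> (n - 3) = \<beta> (n - 3)"
      and low: "restrict \<alpha> {..<n - 3} = restrict \<beta> {..<n - 3}"
      using eq by (simp_all add: \<phi>_def)
    show "\<alpha> = \<beta>"
    proof (rule PiE_ext)
      show "\<alpha> \<in> {..<n + 1} \<rightarrow>\<^sub>E ?I" "\<beta> \<in> {..<n + 1} \<rightarrow>\<^sub>E ?I"
        using \<alpha> \<beta> by (auto simp: T_def int_box_eq)
      fix i assume "i \<in> {..<n + 1}"
      then consider "i < n - 3" | "i = n - 3" | "i = n - 2" | "i = n - 1" | "i = n" by fastforce
      then show "\<alpha> i = \<beta> i" using top fun_cong[OF low, of i] by cases auto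
    qed
  qed
  moreover have "\<phi> ` T \<subseteq> S \<times> ({..<n - 3} \<rightarrow>\<^sub>E ?I)"
  proof
    fix x assume "x \<in> \<phi> ` T"
    then obtain \<alpha> p where x: "x = \<phi> \<alpha>" and \<alpha>: "\<alpha> \<in> {..<n + 1} \<rightarrow>\<^sub>E ?I"
      and p: "prime (p::nat)" "p > M" "loc_affine_eisenstein n (int p) \<alpha>"
      by (auto simp: T_def int_box_eq)
    have "cone_quadrics_dvd n p (\<alpha> n) (\<alpha> (n - 1)) (\<alpha> (n - 2)) (\<alpha> (n - 3))"
      using loc_affine_eisenstein_quadrics[OF n p(3)] by (simp add: cone_quadrics_dvd_def)
    moreover have "\<alpha> i \<in> ?I" if "i < n + 1" for i using PiE_mem[OF \<alpha>, of i] that by simp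
    ultimately show "x \<in> S \<times> ({..<n - 3} \<rightarrow>\<^sub>E ?I)"
      using p unfolding x \<phi>_def S_def by auto
  qed
  ultimately have "card T \<le> card (S \<times> ({..<n - 3} \<rightarrow>\<^sub>E ?I))"
    by (intro card_inj_on_le) (auto simp: fin finite_PiE finite_int_interval)
  then have "real (card T) \<le> real (card S) * real (card ?I) ^ (n - 3)"
    by (simp add: card_cartesian_product card_PiE flip: of_nat_power of_nat_mult)
  also have "\<dots> \<le> (378 * B ^ 4 / M) * (3 * B) ^ (n - 3)"
    using card_cone_quadrics_tail[OF assms] card_int_interval_bounds[of B] M0
    by (intro mult_mono power_mono) (auto simp: S_def)
  also have "\<dots> = 378 * 3 ^ (n - 3) * B ^ (n + 1) / M"
  proof -
    have "B ^ (n + 1) = B ^ 4 * B ^ (n - 3)" using n by (simp flip: power_add)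
    then show ?thesis by (simp add: power_mult_distrib)
  qed
  also have "\<dots> \<le> (378 * 2 ^ n / M) * (2 * B) ^ (n + 1)"
  proof -
    have "(3::real) ^ (n - 3) \<le> 4 ^ (n - 3)" by (intro power_mono) auto
    also have "\<dots> \<le> 4 ^ n" by (intro power_increasing) auto
    also have "(4::real) ^ n = 2 ^ n * 2 ^ n" by (simp flip: power_mult_distrib)
    also have "\<dots> \<le> 2 ^ n * 2 ^ (n + 1)" by simp
    finally have "3 ^ (n - 3) * (378 * B ^ (n + 1) / M) \<le> (2 ^ n * 2 ^ (n + 1)) * (378 * B ^ (n + 1) / M)"
      using M0 by (intro mult_right_mono) auto
    then show ?thesis by (simp add: power_mult_distrib mult_ac)
  qed
  finally have "real (card T) \<le> (378 * 2 ^ n / M) * (2 * B) ^ (n + 1)" .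
  then show ?thesis using M0 unfolding T_def by (simp add: pos_divide_le_eq del: power_Suc)
qed

section \<open>The density\<close>

text \<open>
  The local densities are at most \<open>1 / p\<^sup>2\<close> because \<open>(p + 1) * (p - 1)\<^sup>2 \<le> p ^ 3\<close> and \<open>n \<ge> 3\<close>, so
  the infinite product converges absolutely.
\<close>

lemma local_densities_product_tendsto:
  assumes n: "n \<ge> 3"
  shows "(\<lambda>M. \<Prod>p\<in>{p. p \<le> M \<and> prime p}. 1 - (real p + 1) * (real p - 1)\<^sup>2 / real p ^ (n + 2))
    \<longlonglongrightarrow> (\<Prod>p::nat. if prime p then 1 - (real p + 1) * (real p - 1)\<^sup>2 / real p ^ (n + 2) else 1)"
proof -
  define f where "f p = (if prime p then 1 - (real p + 1) * (real p - 1)\<^sup>2 / real p ^ (n + 2) else 1)" for p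
  have bound: "norm (f p - 1) \<le> 1 / (real p)\<^sup>2" for p
  proof (cases "prime p")
    case True
    define x where "x = real p"
    have x: "x \<ge> 1" using True prime_ge_1_nat by (simp add: x_def)
    have "(x + 1) * (x - 1)\<^sup>2 = (x\<^sup>2 - 1) * (x - 1)" by (simp add: power2_eq_square algebra_simps)
    also have "\<dots> \<le> x\<^sup>2 * x" using x by (intro mult_mono) auto
    also have "\<dots> = x ^ 5 / x\<^sup>2" using x by (simp add: eval_nat_numeral)
    also have "\<dots> \<le> x ^ (n + 2) / x\<^sup>2" using x n by (intro divide_right_mono power_increasing) auto
    finally have "(x + 1) * (x - 1)\<^sup>2 / x ^ (n + 2) \<le> 1 / x\<^sup>2" using x by (simp add: field_simps)
    moreover have "(x + 1) * (x - 1)\<^sup>2 / x ^ (n + 2) \<ge> 0" using x by simp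
    ultimately show ?thesis using True by (simp add: f_def x_def)
  qed (simp add: f_def)
  have "summable (\<lambda>p. norm (f p - 1))"
  proof (rule summable_comparison_test'[of "\<lambda>p. 1 / (real p)\<^sup>2" 0])
    show "summable (\<lambda>p. 1 / (real p)\<^sup>2)"
      using inverse_power_summable[of 2, where 'a = real] by (simp add: inverse_eq_divide)
    fix p show "norm (norm (f p - 1)) \<le> 1 / (real p)\<^sup>2"
      using bound[of p] by (simp only: real_norm_def abs_idempotent)
  qed
  then have "convergent_prod f"
    by (intro abs_convergent_prod_imp_convergent_prod summable_imp_abs_convergent_prod)
  then have "(\<lambda>M. \<Prod>p\<le>M. f p) \<longlonglongrightarrow> (\<Prod>p. f p)" by (rule convergent_prod_LIMSEQ)
  moreover have "(\<Prod>p\<le>M. f p) = (\<Prod>p\<in>{p. p \<le> M \<and> prime p}. 1 - (real p + 1) * (real p - 1)\<^sup>2 / real p ^ (n + 2))" for M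
    unfolding f_def by (subst prod.inter_filter[symmetric]) auto
  ultimately show ?thesis unfolding f_def by simp
qed

theorem theorem19:
  fixes n :: nat
  assumes "n \<ge> 3"
  shows "has_natural_density (n + 1) (coeff_vec n ` affine_eisenstein_polys n)
           (1 - (\<Prod>p::nat. if prime p
                   then 1 - (real p + 1) * (real p - 1)\<^sup>2 / real p ^ (n + 2)
                   else 1))"
proof -
  define L where "L = (\<Prod>p::nat. if prime p then 1 - (real p + 1) * (real p - 1)\<^sup>2 / real p ^ (n + 2) else 1)"
  define \<pi> where "\<pi> M = (\<Prod>p\<in>{p. p \<le> M \<and> prime p}. 1 - (real p + 1) * (real p - 1)\<^sup>2 / real p ^ (n + 2))" for M :: nat
  define vol where "vol B = (2 * B) ^ (n + 1)" for B :: real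
  let ?loc = "\<lambda>p \<alpha>. prime (p::nat) \<and> loc_affine_eisenstein n (int p) \<alpha>"
  define full where "full B = real (card (int_box (n + 1) B)) / vol B" for B
  define avoid where "avoid M B = real (card {\<alpha> \<in> int_box (n + 1) B. \<forall>p\<le>M. \<not> ?loc p \<alpha>}) / vol B" for M B
  define tail where "tail M B = real (card {\<alpha> \<in> int_box (n + 1) B. \<exists>p>M. ?loc p \<alpha>}) / vol B" for M B
  define s where "s B = real (card {\<alpha> \<in> int_box (n + 1) B. \<exists>p. ?loc p \<alpha>}) / vol B" for B
  have full_lim: "(full \<longlongrightarrow> 1) at_top"
    using tendsto_avoiding_primes_density[of n "{}"] assms by (simp add: full_def[abs_def] vol_def)
  have avoid_lim: "(avoid M \<longlongrightarrow> \<pi> M) at_top" for M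
  proof -
    have eq: "{\<alpha> \<in> int_box (n + 1) B. \<forall>p\<le>M. \<not> ?loc p \<alpha>}
       = {\<alpha> \<in> int_box (n + 1) B. \<forall>p\<in>{p. p \<le> M \<and> prime p}. \<not> loc_affine_eisenstein n (int p) \<alpha>}" for B
      by auto
    show ?thesis
      unfolding avoid_def[abs_def] \<pi>_def vol_def eq
      by (rule tendsto_avoiding_primes_density) (use assms in auto)
  qed
  have pi_lim: "\<pi> \<longlonglongrightarrow> L"
    using local_densities_product_tendsto[OF assms] by (simp add: \<pi>_def[abs_def] L_def)
  \<comment> \<open>The wanted set contains the vectors that are met by a prime up to \<open>M\<close>, and exceeds them only by
    vectors that are met by a prime above \<open>M\<close>.\<close>
  have squeeze: "full B - avoid M B \<le> s B \<and> s B \<le> full B - avoid M B + tail M B" if "B > 0" for M B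
  proof -
    let ?X = "int_box (n + 1) B"
    define S where "S = {\<alpha> \<in> ?X. \<exists>p. ?loc p \<alpha>}"
    define A where "A = {\<alpha> \<in> ?X. \<forall>p\<le>M. \<not> ?loc p \<alpha>}"
    define T where "T = {\<alpha> \<in> ?X. \<exists>p>M. ?loc p \<alpha>}"
    have fin: "finite ?X" "finite S" "finite A" "finite T"
      by (auto simp: S_def A_def T_def finite_int_box)
    have A: "card (?X - A) = card ?X - card A" "card A \<le> card ?X"
      using fin by (auto simp: A_def card_Diff_subset intro!: card_mono)
    have "card (?X - A) \<le> card S"
      using fin by (intro card_mono) (auto simp: S_def A_def)
    moreover have "S \<subseteq> (?X - A) \<union> T"
    proof
      fix \<alpha> assume "\<alpha> \<in> S"
      then obtain p where p: "\<alpha> \<in> ?X" "?loc p \<alpha>" by (auto simp: S_def)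
      show "\<alpha> \<in> (?X - A) \<union> T"
        using p by (cases "p \<le> M") (auto simp: A_def T_def not_le)
    qed
    then have "card S \<le> card ((?X - A) \<union> T)"
      using fin by (intro card_mono) auto
    moreover have "card ((?X - A) \<union> T) \<le> card (?X - A) + card T" by (rule card_Un_le)
    ultimately have "real (card ?X) - real (card A) \<le> real (card S)"
      "real (card S) \<le> real (card ?X) - real (card A) + real (card T)"
      using A by linarith+
    moreover have "vol B > 0" using that by (simp add: vol_def)
    ultimately show ?thesis
      unfolding full_def avoid_def tail_def s_def S_def A_def T_def
      by (simp add: divide_right_mono flip: diff_divide_distrib add_divide_distrib)
  qed
  have "(s \<longlongrightarrow> 1 - L) at_top"
  proof (rule tendstoI)
    fix e :: real assume e: "e > 0"
    define \<tau> where "\<tau> M = 378 * 2 ^ n / real M" for M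
    have "\<tau> \<longlonglongrightarrow> 0" unfolding \<tau>_def by real_asymp
    then have "\<forall>\<^sub>F M in sequentially. \<tau> M < e / 3"
      using e by (intro order_tendstoD) auto
    moreover have "\<forall>\<^sub>F M in sequentially. dist (\<pi> M) L < e / 3"
      using pi_lim e by (intro tendstoD) auto
    moreover have "\<forall>\<^sub>F M in sequentially. M \<ge> 3 * n" by (rule eventually_ge_at_top)
    ultimately obtain M where M: "\<tau> M < e / 3" "dist (\<pi> M) L < e / 3" "M \<ge> 3 * n"
      by (metis (mono_tags, lifting) eventually_conj eventually_happens' sequentially_bot)
    have "((\<lambda>B. full B - avoid M B) \<longlongrightarrow> 1 - \<pi> M) at_top"
      by (intro tendsto_diff full_lim avoid_lim)
    then have "\<forall>\<^sub>F B in at_top. dist (full B - avoid M B) (1 - \<pi> M) < e / 3"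
      using e by (intro tendstoD) auto
    then show "\<forall>\<^sub>F B in at_top. dist (s B) (1 - L) < e"
      using eventually_ge_at_top[of "real M"] eventually_gt_at_top[of 0]
    proof eventually_elim
      case (elim B)
      have "tail M B \<le> \<tau> M"
        using loc_affine_eisenstein_tail[OF assms M(3) elim(2)]
        by (simp add: tail_def vol_def \<tau>_def conj_commute conj_left_commute)
      then show ?case
        using squeeze[OF elim(3), of M] elim(1) M(1,2) unfolding dist_real_def by linarith
    qed
  qed
  moreover have "n \<ge> 2" using assms by simp
  ultimately show ?thesis
    unfolding has_natural_density_def L_def[symmetric] affine_eisenstein_vecs_in_box[OF \<open>n \<ge> 2\<close>]
    by (simp add: s_def[abs_def] vol_def)
qed

end
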